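(* For any $n,d\in\mathbb{N}$ there exist finite simple connected graphs $G$ with $|V(G)|\ge n$ and $\operatorname{diam}(G)\ge d$ such that: (1) $G$ is DDR but not $1$-CDDR; and likewise there exist such graphs such that: (2) $G$ is $1$-CDDR but not CDDR. Furthermore, in each of the cases (1) and (2), the graph $G$ can be chosen to independently satisfy or fail the DMR and DWR properties (i.e. for each of the four combinations of DMR/not DMR and DWR/not DWR, such a $G$ exists).
   Context: $\Gamma_i(u)$ is the set of vertices at distance exactly $i$ from $u$. For a finite simple connected graph $G$: DDR (distance degree-regular): $|\Gamma_i(u)|=|\Gamma_i(v)|$ for all vertices $u,v$ and all $i$. CDDR (commutative distance degree-regular): $|\Gamma_i(u)\cap\Gamma_j(v)|=|\Gamma_i(v)\cap\Gamma_j(u)|$ for all vertices $u,v$ and all $1\le i,j\le\operatorname{diam}(G)$. $1$-CDDR: $|\Gamma_1(u)\cap\Gamma_j(v)|=|\Gamma_1(v)\cap\Gamma_j(u)|$ for all vertices $u,v$ and all $1\le j\le\operatorname{diam}(G)$. DMR (distance mean-regular): for all $0\le h,i,j\le\operatorname{diam}(G)$ the average $\frac{1}{|\Gamma_h(u)|}\sum_{v\in\Gamma_h(u)}|\Gamma_i(u)\cap\Gamma_j(v)|$ depends only on $h,i,j$ and not on $u$. DWR (distance walk regular): for all vertices $u,v$ and all $k\in\mathbb{N}$ the existence of a walk of length $k$ between $u$ and $v$ depends only on $k$ and $d(u,v)$. *)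

theory Defs
  imports "Graph_Theory.Graph_Theory"
begin

text \<open>
  A finite simple graph is a \<^locale>\<open>pair_graph\<close>: an edge \<open>uv\<close> is represented by the
  two arcs \<open>(u,v)\<close> and \<open>(v,u)\<close>.
\<close>

definition has_walk :: "'a pair_pre_digraph \<Rightarrow> nat \<Rightarrow> 'a \<Rightarrow> 'a \<Rightarrow> bool" where
  "has_walk G k u v \<longleftrightarrow> (\<exists>p. pre_digraph.awalk (with_proj G) u p v \<and> length p = k)"

text \<open>
  The distance is only used in connected graphs, where the set of walk lengths below is
  nonempty; there it is the library's shortest-path distance for unit weights
  (\<open>graph_dist_eq_mu\<close> below).
\<close>

definition graph_dist :: "'a pair_pre_digraph \<Rightarrow> 'a \<Rightarrow> 'a \<Rightarrow> nat" where
  "graph_dist G u v = (LEAST k. has_walk G k u v)"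

definition graph_diam :: "'a pair_pre_digraph \<Rightarrow> nat" where
  "graph_diam G = Max {graph_dist G u v | u v. u \<in> pverts G \<and> v \<in> pverts G}"

definition Gam :: "'a pair_pre_digraph \<Rightarrow> nat \<Rightarrow> 'a \<Rightarrow> 'a set" where
  "Gam G i u = {v \<in> pverts G. graph_dist G u v = i}"

definition DDR :: "'a pair_pre_digraph \<Rightarrow> bool" where
  "DDR G \<longleftrightarrow> (\<forall>u\<in>pverts G. \<forall>v\<in>pverts G. \<forall>i. card (Gam G i u) = card (Gam G i v))"

definition CDDR :: "'a pair_pre_digraph \<Rightarrow> bool" where
  "CDDR G \<longleftrightarrow> (\<forall>u\<in>pverts G. \<forall>v\<in>pverts G.
     \<forall>i\<in>{1..graph_diam G}. \<forall>j\<in>{1..graph_diam G}.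
       card (Gam G i u \<inter> Gam G j v) = card (Gam G i v \<inter> Gam G j u))"

definition one_CDDR :: "'a pair_pre_digraph \<Rightarrow> bool" where
  "one_CDDR G \<longleftrightarrow> (\<forall>u\<in>pverts G. \<forall>v\<in>pverts G. \<forall>j\<in>{1..graph_diam G}.
       card (Gam G 1 u \<inter> Gam G j v) = card (Gam G 1 v \<inter> Gam G j u))"

definition mean_intersection :: "'a pair_pre_digraph \<Rightarrow> nat \<Rightarrow> nat \<Rightarrow> nat \<Rightarrow> 'a \<Rightarrow> real" where
  "mean_intersection G h i j u =
     (\<Sum>v\<in>Gam G h u. real (card (Gam G i u \<inter> Gam G j v))) / real (card (Gam G h u))"

text \<open>
  If \<open>Gam G h u\<close> is empty, the mean is \<open>0/0\<close>, which is \<open>0\<close> here. This cannot happen in a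
  connected DDR graph for \<open>h\<close> up to the diameter, and connected 1-CDDR graphs are DDR (each
  distance matrix commutes with the adjacency matrix, hence preserves its simple eigenspace
  spanned by the all-ones vector), so the convention is immaterial for such graphs.
\<close>

definition DMR :: "'a pair_pre_digraph \<Rightarrow> bool" where
  "DMR G \<longleftrightarrow> (\<forall>h\<in>{0..graph_diam G}. \<forall>i\<in>{0..graph_diam G}. \<forall>j\<in>{0..graph_diam G}.
     \<forall>u\<in>pverts G. \<forall>u'\<in>pverts G. mean_intersection G h i j u = mean_intersection G h i j u')"

definition DWR :: "'a pair_pre_digraph \<Rightarrow> bool" where
  "DWR G \<longleftrightarrow> (\<forall>u\<in>pverts G. \<forall>v\<in>pverts G. \<forall>u'\<in>pverts G. \<forall>v'\<in>pverts G.
     graph_dist G u v = graph_dist G u' v' \<longrightarrow> (\<forall>k. has_walk G k u v \<longleftrightarrow> has_walk G k u' v'))"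

definition connected_simple_graph :: "'a pair_pre_digraph \<Rightarrow> bool" where
  "connected_simple_graph G \<longleftrightarrow> pair_graph G \<and> Digraph_Component.connected (with_proj G)"

lemma graph_dist_eq_mu:
  assumes G: "connected_simple_graph G" and u: "u \<in> pverts G" and v: "v \<in> pverts G"
  shows "wf_digraph.\<mu> (with_proj G) (\<lambda>_. 1) u v = ereal (real (graph_dist G u v))"
proof -
  interpret pair_graph G using G by (simp add: connected_simple_graph_def)
  have "strongly_connected (with_proj G)"
    using G pair_sym_arcs symmetric_connected_imp_strongly_connected
    by (simp add: connected_simple_graph_def)
  then have "u \<rightarrow>\<^sup>*\<^bsub>with_proj G\<^esub> v" using u v by (auto simp: strongly_connected_def)
  then have ex: "\<exists>k. has_walk G k u v" by (auto simp: reachable_awalk has_walk_def)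
  have cost: "awalk_cost (\<lambda>_. 1) p = real (length p)" for p :: "('a \<times> 'a) list"
    by (induct p) auto
  have least: "has_walk G (graph_dist G u v) u v"
    unfolding graph_dist_def using ex by (rule LeastI_ex)
  then obtain p where p: "awalk u p v" "length p = graph_dist G u v"
    by (auto simp: has_walk_def)
  have "graph_dist G u v \<le> length q" if "awalk u q v" for q
    unfolding graph_dist_def by (rule Least_le) (use that in \<open>auto simp: has_walk_def\<close>)
  then show ?thesis
    unfolding \<mu>_def cost by (intro antisym INF_lower2[of p] INF_greatest) (use p in auto)
qed

end

theory Submission
  imports Defs
begin

text \<open>
  Write \<open>A\<^sub>i\<close> for the matrix of the relation ``at distance \<open>i\<close>''. A graph is CDDR if all \<open>A\<^sub>i\<close> commute with
  each other, and 1-CDDR if the adjacency matrix \<open>A\<^sub>1\<close> commutes with all of them. Two finite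
  vertex-transitive graphs are the source of all examples: a Cayley graph on \<open>12\<close> vertices in which
  \<open>A\<^sub>1\<close> and \<open>A\<^sub>2\<close> do not commute (\<open>not_commuting_12\<close>), and a Cayley graph on \<open>64\<close> vertices in which \<open>A\<^sub>1\<close>
  commutes with every \<open>A\<^sub>j\<close> but \<open>A\<^sub>2\<close> and \<open>A\<^sub>3\<close> do not commute (\<open>commuting_1_64\<close>, \<open>not_commuting_64\<close>).

  Everything else is obtained with Cartesian products. Distances add up in a product, so
  the counts that define DDR, 1-CDDR, CDDR and DMR are convolutions of those of the factors. Hence
  1-CDDR passes to products of 1-CDDR graphs, while the first failure of commutation in a
  factor cannot be repaired by another factor (\<open>not_commuting\<close>). Each further demand is then met by
  one more construction that keeps 1-CDDR:

  \<^item> A hypercube makes the number of vertices and the diameter large.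

  \<^item> Replacing each vertex by two adjacent copies preserves all commutation relations and puts every
    edge into a triangle. Then walks can be lengthened one step at a time, and the graph is
    DWR (\<open>triangles_DWR\<close>). A factor consisting of one edge adds edges outside all
    triangles and makes the graph fail DWR.

  \<^item> Vertex-transitive graphs are DMR. Since triangle counts add up in products, a factor whose
    vertices lie in different numbers of triangles makes the graph fail DMR (\<open>not_DMR\<close>); a
    regular graph on \<open>7\<close> vertices does this without spoiling DDR.
\<close>

section \<open>Graphs as geodesic distance functions\<close>

text \<open>
  All graph properties at issue speak only of distances and of walk lengths. A graph is therefore
  handled through its distance function; the last two conditions say that distances change by at
  most one along an edge and that some neighbour of \<open>u\<close> is closer to \<open>v\<close>, which together
  characterize shortest-path distances. This makes products and other constructions formulas
  for the new distance, with no walks to build.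
\<close>

locale geodesic_space =
  fixes V :: "'a set" and D :: "'a \<Rightarrow> 'a \<Rightarrow> nat"
  assumes finite_V: "finite V" and nonempty_V: "V \<noteq> {}"
    and dist_0: "u \<in> V \<Longrightarrow> v \<in> V \<Longrightarrow> D u v = 0 \<longleftrightarrow> u = v"
    and dist_sym: "u \<in> V \<Longrightarrow> v \<in> V \<Longrightarrow> D u v = D v u"
    and dist_step: "u \<in> V \<Longrightarrow> w \<in> V \<Longrightarrow> v \<in> V \<Longrightarrow> D u w = 1 \<Longrightarrow> D u v \<le> Suc (D w v)"
    and dist_descend: "u \<in> V \<Longrightarrow> v \<in> V \<Longrightarrow> D u v = Suc k \<Longrightarrow> \<exists>w\<in>V. D u w = 1 \<and> D w v = k"

definition graph_of :: "'a set \<Rightarrow> ('a \<Rightarrow> 'a \<Rightarrow> nat) \<Rightarrow> 'a pair_pre_digraph" where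
  "graph_of V D = \<lparr>pverts = V, parcs = {(u, v). u \<in> V \<and> v \<in> V \<and> D u v = 1}\<rparr>"

definition sphere :: "'a set \<Rightarrow> ('a \<Rightarrow> 'a \<Rightarrow> nat) \<Rightarrow> nat \<Rightarrow> 'a \<Rightarrow> 'a set" where
  "sphere V D i u = {w \<in> V. D u w = i}"

definition common :: "'a set \<Rightarrow> ('a \<Rightarrow> 'a \<Rightarrow> nat) \<Rightarrow> nat \<Rightarrow> nat \<Rightarrow> 'a \<Rightarrow> 'a \<Rightarrow> nat" where
  "common V D i j u v = card {w \<in> V. D u w = i \<and> D v w = j}"

text \<open>
  If \<open>A\<^sub>i\<close> is the 0/1 matrix of the relation ``at distance \<open>i\<close>'', then \<open>common V D i j u v\<close> is the
  \<open>(u, v)\<close> entry of \<open>A\<^sub>i A\<^sub>j\<close>, and its symmetry says that \<open>A\<^sub>i\<close> and \<open>A\<^sub>j\<close> commute.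
\<close>

definition commuting :: "'a set \<Rightarrow> ('a \<Rightarrow> 'a \<Rightarrow> nat) \<Rightarrow> nat \<Rightarrow> nat \<Rightarrow> bool" where
  "commuting V D i j \<longleftrightarrow> (\<forall>u\<in>V. \<forall>v\<in>V. common V D i j u v = common V D i j v u)"

definition distance_degree_regular :: "'a set \<Rightarrow> ('a \<Rightarrow> 'a \<Rightarrow> nat) \<Rightarrow> bool" where
  "distance_degree_regular V D \<longleftrightarrow>
     (\<forall>i. \<forall>u\<in>V. \<forall>v\<in>V. card (sphere V D i u) = card (sphere V D i v))"

lemma pverts_graph_of [simp]: "pverts (graph_of V D) = V"
  by (simp add: graph_of_def)

lemma parcs_graph_of [simp]: "(u, v) \<in> parcs (graph_of V D) \<longleftrightarrow> u \<in> V \<and> v \<in> V \<and> D u v = 1"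
  by (simp add: graph_of_def)

context geodesic_space
begin

lemma dist_refl [simp]: "u \<in> V \<Longrightarrow> D u u = 0"
  by (simp add: dist_0)

abbreviation "G \<equiv> graph_of V D"

lemma pair_graph: "pair_graph G"
proof
  show "finite (parcs G)"
    by (rule finite_subset[of _ "V \<times> V"]) (auto simp: graph_of_def finite_V)
  show "symmetric (with_proj G)"
    unfolding symmetric_def by (auto simp: dist_sym intro!: symI)
qed (auto simp: finite_V)

sublocale pair_graph G by (rule pair_graph)

lemma has_walk_0: "has_walk G 0 u v \<longleftrightarrow> u = v \<and> u \<in> V"
  by (auto simp: has_walk_def awalk_Nil_iff)

lemma has_walk_Suc:
  "has_walk G (Suc k) u v \<longleftrightarrow> u \<in> V \<and> (\<exists>w\<in>V. D u w = 1 \<and> has_walk G k w v)"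
proof
  assume "has_walk G (Suc k) u v"
  then obtain e p where "awalk u (e # p) v" "length p = k"
    by (auto simp: has_walk_def length_Suc_conv)
  then show "u \<in> V \<and> (\<exists>w\<in>V. D u w = 1 \<and> has_walk G k w v)"
    by (cases e) (auto simp: has_walk_def awalk_Cons_iff)
next
  assume "u \<in> V \<and> (\<exists>w\<in>V. D u w = 1 \<and> has_walk G k w v)"
  then obtain w p where "u \<in> V" "w \<in> V" "D u w = 1" "awalk w p v" "length p = k"
    by (auto simp: has_walk_def)
  then have "awalk u ((u, w) # p) v" by (auto simp: awalk_Cons_iff)
  with \<open>length p = k\<close> show "has_walk G (Suc k) u v"
    unfolding has_walk_def by (intro exI[of _ "(u, w) # p"]) simp
qed

lemma has_walk_1: "has_walk G (Suc 0) u v \<longleftrightarrow> u \<in> V \<and> v \<in> V \<and> D u v = 1"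
  by (auto simp: has_walk_Suc has_walk_0)

lemma has_walk_dist: "u \<in> V \<Longrightarrow> v \<in> V \<Longrightarrow> has_walk G (D u v) u v"
proof (induction "D u v" arbitrary: u)
  case 0 then show ?case by (metis dist_0 has_walk_0)
next
  case (Suc k)
  obtain w where w: "w \<in> V" "D u w = 1" "D w v = k"
    using dist_descend Suc.prems Suc.hyps(2) by metis
  with Suc.hyps(1)[of w] Suc.prems have "has_walk G k w v" by simp
  with w Suc.prems have "has_walk G (Suc k) u v" by (auto simp: has_walk_Suc)
  with Suc.hyps(2) show ?case by simp
qed

lemma dist_le_walk: "has_walk G k u v \<Longrightarrow> v \<in> V \<Longrightarrow> D u v \<le> k"
proof (induction k arbitrary: u)
  case 0 then show ?case by (auto simp: has_walk_0 dist_0)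
next
  case (Suc k)
  then obtain w where "u \<in> V" "w \<in> V" "D u w = 1" "has_walk G k w v" by (auto simp: has_walk_Suc)
  with Suc.IH[of w] Suc.prems dist_step[of u w v] show ?case by simp
qed

lemma graph_dist_eq: "u \<in> V \<Longrightarrow> v \<in> V \<Longrightarrow> graph_dist G u v = D u v"
  unfolding graph_dist_def by (rule Least_equality) (auto simp: has_walk_dist dist_le_walk)

lemma connected_simple_graph: "connected_simple_graph G"
proof -
  have "u \<rightarrow>\<^sup>*\<^bsub>with_proj G\<^esub> v" if "u \<in> V" "v \<in> V" for u v
    using has_walk_dist[OF that] by (auto simp: has_walk_def reachable_awalk)
  then have "Digraph_Component.connected (with_proj G)"
    unfolding connected_def using nonempty_V
    by (intro strongly_connectedI) (auto intro: reachable_mk_symmetricI)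
  with pair_graph show ?thesis by (simp add: connected_simple_graph_def)
qed

lemma Gam_eq: "u \<in> V \<Longrightarrow> Gam G i u = sphere V D i u"
  by (auto simp: Gam_def sphere_def graph_dist_eq)

lemma card_Gam_Int: "u \<in> V \<Longrightarrow> v \<in> V \<Longrightarrow> card (Gam G i u \<inter> Gam G j v) = common V D i j u v"
  by (auto simp: Gam_eq common_def sphere_def intro!: arg_cong[where f=card])

lemma finite_dists: "finite {graph_dist G u v | u v. u \<in> pverts G \<and> v \<in> pverts G}"
  by (rule finite_subset[of _ "(\<lambda>(u, v). graph_dist G u v) ` (V \<times> V)"]) (auto simp: finite_V)

lemma dist_le_diam: "u \<in> V \<Longrightarrow> v \<in> V \<Longrightarrow> D u v \<le> graph_diam G"
  unfolding graph_diam_def by (rule Max_ge[OF finite_dists]) (auto, metis graph_dist_eq)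

lemma DDR_iff: "DDR G \<longleftrightarrow> distance_degree_regular V D"
  by (auto simp: DDR_def distance_degree_regular_def Gam_eq)

lemma common_swap: "common V D i j u v = common V D j i v u"
  by (simp add: common_def conj_commute)

lemma commuting_swap: "commuting V D i j \<longleftrightarrow> commuting V D j i"
  by (metis commuting_def common_swap)

lemma commuting_same: "commuting V D i i"
  by (metis commuting_def common_swap)

lemma common_0: "u \<in> V \<Longrightarrow> v \<in> V \<Longrightarrow> common V D 0 j u v = of_bool (D u v = j)"
proof -
  assume uv: "u \<in> V" "v \<in> V"
  then have "{w \<in> V. D u w = 0 \<and> D v w = j} = (if D u v = j then {u} else {})"
    by (auto simp: dist_0 dist_sym)
  then show ?thesis by (simp add: common_def)
qed

lemma sphere_0: "u \<in> V \<Longrightarrow> sphere V D 0 u = {u}"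
  by (auto simp: sphere_def dist_0)

lemma commuting_0: "commuting V D 0 j"
  by (simp add: commuting_def common_0 dist_sym)

lemma common_beyond_diam:
  assumes "u \<in> V" "v \<in> V" "j > graph_diam G" shows "common V D i j u v = 0"
proof -
  have "{w \<in> V. D u w = i \<and> D v w = j} = {}"
    using dist_le_diam[OF assms(2)] assms(3) by fastforce
  then show ?thesis unfolding common_def by (metis card.empty)
qed

lemma commuting_beyond_diam: "j > graph_diam G \<Longrightarrow> commuting V D i j"
  by (simp add: commuting_def common_beyond_diam)

text \<open>
  The index ranges of the graph properties may be dropped: index \<open>0\<close> is the identity matrix, and
  beyond the diameter the distance matrices vanish.
\<close>

lemma one_CDDR_iff: "one_CDDR G \<longleftrightarrow> (\<forall>j. commuting V D 1 j)"
proof -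
  have "one_CDDR G \<longleftrightarrow> (\<forall>j\<in>{1..graph_diam G}. commuting V D 1 j)"
    unfolding one_CDDR_def commuting_def by (auto simp: card_Gam_Int)
  also have "\<dots> \<longleftrightarrow> (\<forall>j. commuting V D 1 j)"
  proof (intro iffI allI)
    fix j assume *: "\<forall>j\<in>{1..graph_diam G}. commuting V D 1 j"
    consider "j = 0" | "j \<in> {1..graph_diam G}" | "j > graph_diam G" by force
    then show "commuting V D 1 j"
      using * commuting_0[of 1] commuting_swap[of 1 0] commuting_beyond_diam[of j 1]
      by cases auto
  qed auto
  finally show ?thesis .
qed

lemma CDDR_iff: "CDDR G \<longleftrightarrow> (\<forall>i j. commuting V D i j)"
proof -
  have "CDDR G \<longleftrightarrow> (\<forall>i\<in>{1..graph_diam G}. \<forall>j\<in>{1..graph_diam G}. commuting V D i j)"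
    unfolding CDDR_def commuting_def by (auto simp: card_Gam_Int)
  also have "\<dots> \<longleftrightarrow> (\<forall>i j. commuting V D i j)"
  proof (intro iffI allI)
    fix i j assume *: "\<forall>i\<in>{1..graph_diam G}. \<forall>j\<in>{1..graph_diam G}. commuting V D i j"
    consider "i = 0 \<or> j = 0" | "i \<in> {1..graph_diam G}" "j \<in> {1..graph_diam G}"
      | "i > graph_diam G \<or> j > graph_diam G" by force
    then show "commuting V D i j"
      using * commuting_0[of i] commuting_0[of j] commuting_swap[of i j]
        commuting_beyond_diam[of j i] commuting_beyond_diam[of i j]
      by cases auto
  qed auto
  finally show ?thesis .
qed

lemma mean_intersection_eq:
  "u \<in> V \<Longrightarrow> mean_intersection G h i j u =
     real (\<Sum>v\<in>sphere V D h u. common V D i j u v) / real (card (sphere V D h u))"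
proof -
  assume u: "u \<in> V"
  have "(\<Sum>v\<in>sphere V D h u. real (card (Gam G i u \<inter> Gam G j v)))
      = (\<Sum>v\<in>sphere V D h u. real (common V D i j u v))"
    by (rule sum.cong) (auto simp: card_Gam_Int u sphere_def)
  then show ?thesis by (simp add: mean_intersection_def Gam_eq[OF u])
qed
end

section \<open>Isometries and homogeneous spaces\<close>

definition isometry ::
  "'a set \<Rightarrow> ('a \<Rightarrow> 'a \<Rightarrow> nat) \<Rightarrow> 'b set \<Rightarrow> ('b \<Rightarrow> 'b \<Rightarrow> nat) \<Rightarrow> ('a \<Rightarrow> 'b) \<Rightarrow> bool" where
  "isometry V D W E f \<longleftrightarrow> bij_betw f V W \<and> (\<forall>x\<in>V. \<forall>y\<in>V. E (f x) (f y) = D x y)"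

text \<open>
  Vertex-transitivity of the graph: an automorphism is an isometry of the distance function.
\<close>

definition homogeneous :: "'a set \<Rightarrow> ('a \<Rightarrow> 'a \<Rightarrow> nat) \<Rightarrow> bool" where
  "homogeneous V D \<longleftrightarrow> (\<forall>u\<in>V. \<forall>v\<in>V. \<exists>f. isometry V D V D f \<and> f u = v)"

lemma isometry_sphere:
  assumes "isometry V D W E f" "u \<in> V"
  shows "sphere W E i (f u) = f ` sphere V D i u"
  using assms unfolding isometry_def sphere_def bij_betw_def by auto

lemma isometry_common:
  assumes f: "isometry V D W E f" and uv: "u \<in> V" "v \<in> V"
  shows "common W E i j (f u) (f v) = common V D i j u v"
proof -
  have "{w \<in> W. E (f u) w = i \<and> E (f v) w = j} = f ` {w \<in> V. D u w = i \<and> D v w = j}"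
    using f uv unfolding isometry_def bij_betw_def by auto
  moreover have "inj_on f {w \<in> V. D u w = i \<and> D v w = j}"
    by (rule inj_on_subset[of _ V]) (use f in \<open>auto simp: isometry_def bij_betw_def\<close>)
  ultimately show ?thesis by (simp add: common_def card_image)
qed

lemma isometry_inj_on_sphere: "isometry V D W E f \<Longrightarrow> inj_on f (sphere V D i u)"
  by (rule inj_on_subset[of _ V]) (auto simp: isometry_def bij_betw_def sphere_def)

lemma isometry_card_sphere:
  "isometry V D W E f \<Longrightarrow> u \<in> V \<Longrightarrow> card (sphere W E i (f u)) = card (sphere V D i u)"
  by (simp add: isometry_sphere card_image isometry_inj_on_sphere)

lemma isometry_sum_common:
  assumes f: "isometry V D W E f" and u: "u \<in> V"
  shows "(\<Sum>v\<in>sphere W E h (f u). common W E i j (f u) v) = (\<Sum>v\<in>sphere V D h u. common V D i j u v)"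
  unfolding isometry_sphere[OF f u] sum.reindex[OF isometry_inj_on_sphere[OF f]] comp_def
  by (rule sum.cong) (auto simp: isometry_common[OF f u] sphere_def)

lemma isometry_compose:
  assumes "isometry V D W E f" "isometry W E X F g"
  shows "isometry V D X F (\<lambda>x. g (f x))"
  using assms bij_betw_trans[of f V W g X] unfolding isometry_def by (auto simp: bij_betw_def comp_def)

lemma isometry_inverse:
  assumes f: "isometry V D W E f"
  shows "isometry W E V D (inv_into V f)"
  unfolding isometry_def
proof (intro conjI ballI)
  show "bij_betw (inv_into V f) W V" using f by (simp add: isometry_def bij_betw_inv_into)
  fix x y assume "x \<in> W" "y \<in> W"
  then show "D (inv_into V f x) (inv_into V f y) = E x y"
    using f f_inv_into_f[of x f V] f_inv_into_f[of y f V] inv_into_into[of x f V] inv_into_into[of y f V]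
    unfolding isometry_def bij_betw_def by metis
qed

lemma homogeneousI:
  assumes e: "e \<in> V" and "\<And>v. v \<in> V \<Longrightarrow> \<exists>f. isometry V D V D f \<and> f e = v"
  shows "homogeneous V D"
  unfolding homogeneous_def
proof (intro ballI)
  fix u v assume "u \<in> V" "v \<in> V"
  then obtain f g where f: "isometry V D V D f" "f e = u" and g: "isometry V D V D g" "g e = v"
    using assms(2) by metis
  have "inv_into V f u = e" using f e by (auto simp: isometry_def bij_betw_def)
  then show "\<exists>f. isometry V D V D f \<and> f u = v"
    using isometry_compose[OF isometry_inverse[OF f(1)] g(1)] g(2)
    by (intro exI[of _ "\<lambda>x. g (inv_into V f x)"] conjI) simp_all
qed

lemma homogeneous_distance_degree_regular:
  assumes "homogeneous V D" shows "distance_degree_regular V D"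
  unfolding distance_degree_regular_def
proof (intro allI ballI)
  fix i u v assume uv: "u \<in> V" "v \<in> V"
  with assms obtain f where "isometry V D V D f" "f u = v"
    unfolding homogeneous_def by blast
  then show "card (sphere V D i u) = card (sphere V D i v)"
    using isometry_card_sphere[of V D V D f u i] uv by simp
qed

section \<open>Distance mean-regularity and triangles\<close>

text \<open>
  Twice the number of triangles through \<open>u\<close>. Divided by the degree it is the mean in the definition
  of distance mean-regularity for \<open>h = i = j = 1\<close>, which makes it the simplest obstruction.
\<close>

definition triangle_count :: "'a set \<Rightarrow> ('a \<Rightarrow> 'a \<Rightarrow> nat) \<Rightarrow> 'a \<Rightarrow> nat" where
  "triangle_count V D u = (\<Sum>v\<in>sphere V D 1 u. common V D 1 1 u v)"

context geodesic_space
begin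

lemma homogeneous_DMR: "homogeneous V D \<Longrightarrow> DMR G"
  unfolding DMR_def
proof (intro ballI)
  fix h i j u v assume "homogeneous V D" and "u \<in> pverts G" "v \<in> pverts G"
  then obtain f where f: "isometry V D V D f" "f u = v" and uv: "u \<in> V" "v \<in> V"
    unfolding homogeneous_def pverts_graph_of by blast
  show "mean_intersection G h i j u = mean_intersection G h i j v"
    using isometry_card_sphere[OF f(1) uv(1)] isometry_sum_common[OF f(1) uv(1)] f(2) uv
    by (simp only: mean_intersection_eq)
qed

lemma not_DMR:
  assumes reg: "distance_degree_regular V D" and uv: "u \<in> V" "v \<in> V"
    and neq: "triangle_count V D u \<noteq> triangle_count V D v"
  shows "\<not> DMR G"
proof
  assume "DMR G"
  have deg: "card (sphere V D 1 u) = card (sphere V D 1 v)"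
    using reg uv unfolding distance_degree_regular_def by blast
  have fin: "finite (sphere V D 1 x)" for x by (simp add: sphere_def finite_V)
  have "card (sphere V D 1 u) \<noteq> 0"
  proof
    assume "card (sphere V D 1 u) = 0"
    with deg fin have "sphere V D 1 u = {}" "sphere V D 1 v = {}" by simp_all
    with neq show False by (simp add: triangle_count_def)
  qed
  then have pos: "card (sphere V D 1 u) > 0" by simp
  then obtain w where "w \<in> V" "D u w = 1" by (auto simp: card_gt_0_iff sphere_def)
  then have "1 \<le> graph_diam G" using dist_le_diam[of u w] uv by simp
  then have one: "1 \<in> {0..graph_diam G}" by simp
  have "mean_intersection G 1 1 1 u = mean_intersection G 1 1 1 v"
    by (rule \<open>DMR G\<close>[unfolded DMR_def pverts_graph_of, rule_format, OF one one one uv])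
  then have "real (triangle_count V D u) = real (triangle_count V D v)"
    unfolding mean_intersection_eq[OF uv(1)] mean_intersection_eq[OF uv(2)] deg[symmetric]
      triangle_count_def[symmetric] using pos by (simp add: field_simps)
  with neq show False by simp
qed

end

section \<open>Walk regularity and triangles\<close>

text \<open>
  In a graph of this kind the parity obstruction to walks of a given length disappears, and the
  lengths of the walks between two vertices are determined by their distance.
\<close>

definition edges_in_triangles :: "'a set \<Rightarrow> ('a \<Rightarrow> 'a \<Rightarrow> nat) \<Rightarrow> bool" where
  "edges_in_triangles V D \<longleftrightarrow>
     (\<forall>u\<in>V. \<exists>v\<in>V. D u v = 1) \<and>
     (\<forall>u\<in>V. \<forall>v\<in>V. D u v = 1 \<longrightarrow> (\<exists>w\<in>V. D u w = 1 \<and> D w v = 1))"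

context geodesic_space
begin

lemma triangles_walk_iff:
  assumes tri: "edges_in_triangles V D" and "u \<in> V" and v: "v \<in> V"
  shows "has_walk G k u v \<longleftrightarrow> D u v \<le> k \<and> \<not> (D u v = 0 \<and> k = 1)"
proof
  assume "has_walk G k u v"
  then show "D u v \<le> k \<and> \<not> (D u v = 0 \<and> k = 1)"
    using dist_le_walk[of k u v] assms(2) v by (auto simp: has_walk_1)
next
  \<comment> \<open>Lengthen a walk by one by replacing its first edge by the two other sides of a triangle.\<close>
  have longer: "has_walk G (Suc (Suc k)) x v" if "has_walk G (Suc k) x v" for k x
  proof -
    obtain y where y: "x \<in> V" "y \<in> V" "D x y = 1" "has_walk G k y v"
      using \<open>has_walk G (Suc k) x v\<close> by (auto simp: has_walk_Suc)
    then obtain w where "w \<in> V" "D x w = 1" "D w y = 1"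
      using tri unfolding edges_in_triangles_def by blast
    with y show ?thesis by (auto simp: has_walk_Suc[of "Suc k"] has_walk_Suc[of k])
  qed
  have up: "has_walk G (Suc k + n) x v" if "has_walk G (Suc k) x v" for k x n
    by (induction n) (use that longer in auto)
  have two: "has_walk G 2 v v"
  proof -
    obtain w where "w \<in> V" "D v w = 1" using tri v unfolding edges_in_triangles_def by blast
    then show ?thesis using v dist_sym[of v w]
      by (auto simp: numeral_2_eq_2 has_walk_Suc has_walk_0)
  qed
  assume *: "D u v \<le> k \<and> \<not> (D u v = 0 \<and> k = 1)"
  show "has_walk G k u v"
  proof (cases "D u v")
    case 0
    then have "u = v" using dist_0 assms by simp
    consider "k = 0" | "k \<ge> 2" using * 0 by linarith
    then show ?thesis
    proof cases
      case 1 then show ?thesis using \<open>u = v\<close> v by (simp add: has_walk_0)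
    next
      case 2
      then have "Suc 1 + (k - 2) = k" by simp
      then show ?thesis using up[of 1 v "k - 2"] two \<open>u = v\<close> by (simp only: numeral_2_eq_2 One_nat_def)
    qed
  next
    case (Suc n)
    then show ?thesis using up[of n u "k - Suc n"] has_walk_dist[of u v] assms * by simp
  qed
qed

lemma triangles_DWR: "edges_in_triangles V D \<Longrightarrow> DWR G"
  by (auto simp: DWR_def graph_dist_eq triangles_walk_iff)

text \<open>
  Walks of length two tell an edge in a triangle from an edge in no triangle, although both join
  vertices at distance one.
\<close>

lemma not_DWR:
  assumes "u \<in> V" "v \<in> V" "w \<in> V" "D u v = 1" "D u w = 1" "D w v = 1"
    and "x \<in> V" "y \<in> V" "D x y = 1" and "\<And>z. z \<in> V \<Longrightarrow> D x z = 1 \<Longrightarrow> D z y = 1 \<Longrightarrow> False"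
  shows "\<not> DWR G"
proof
  assume "DWR G"
  have "graph_dist G u v = graph_dist G x y" using assms by (simp add: graph_dist_eq)
  then have "has_walk G 2 u v \<longleftrightarrow> has_walk G 2 x y"
    using assms \<open>DWR G\<close>[unfolded DWR_def pverts_graph_of, rule_format, of u v x y] by blast
  moreover have "has_walk G 2 u v" using assms by (auto simp: numeral_2_eq_2 has_walk_Suc has_walk_0)
  moreover have "\<not> has_walk G 2 x y" using assms(10) by (auto simp: numeral_2_eq_2 has_walk_Suc has_walk_0)
  ultimately show False by simp
qed

end

section \<open>Relabelling by natural numbers\<close>

lemma isometry_has_walk:
  assumes "geodesic_space V D" "geodesic_space W E" and f: "isometry V D W E f" and "u \<in> V" and v: "v \<in> V"
  shows "has_walk (graph_of W E) k (f u) (f v) = has_walk (graph_of V D) k u v"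
proof -
  interpret V: geodesic_space V D by fact
  interpret W: geodesic_space W E by fact
  have W: "W = f ` V" and inj: "inj_on f V" using f by (auto simp: isometry_def bij_betw_def)
  have E: "E (f x) (f y) = D x y" if "x \<in> V" "y \<in> V" for x y using f that by (simp add: isometry_def)
  show ?thesis using \<open>u \<in> V\<close>
  proof (induction k arbitrary: u)
    case 0
    then show ?case using inj v unfolding V.has_walk_0 W.has_walk_0 by (auto simp: W inj_on_eq_iff)
  next
    case (Suc k)
    then show ?case unfolding V.has_walk_Suc W.has_walk_Suc by (auto simp: W E)
  qed
qed

lemma isometry_graph_properties:
  assumes "geodesic_space V D" "geodesic_space W E" and f: "isometry V D W E f"
  defines "G \<equiv> graph_of V D" and "H \<equiv> graph_of W E"
  shows "card (pverts H) = card (pverts G)" "graph_diam H = graph_diam G" "DDR H = DDR G"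
    "one_CDDR H = one_CDDR G" "CDDR H = CDDR G" "DMR H = DMR G" "DWR H = DWR G"
proof -
  interpret V: geodesic_space V D by fact
  interpret W: geodesic_space W E by fact
  have W: "W = f ` V" and inj: "inj_on f V" using f by (auto simp: isometry_def bij_betw_def)
  have E: "E (f x) (f y) = D x y" if "x \<in> V" "y \<in> V" for x y using f that by (simp add: isometry_def)
  have dist: "graph_dist H (f x) (f y) = graph_dist G x y" if "x \<in> V" "y \<in> V" for x y
    using that W.graph_dist_eq[of "f x" "f y"] by (simp add: G_def H_def V.graph_dist_eq E W)
  have walk: "has_walk H k (f x) (f y) = has_walk G k x y" if "x \<in> V" "y \<in> V" for k x y
    unfolding G_def H_def by (rule isometry_has_walk[OF assms(1-3) that])
  have pG: "pverts G = V" and pH: "pverts H = f ` V" by (simp_all add: G_def H_def W)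
  have common: "common W E i j (f u) (f v) = common V D i j u v" if "u \<in> V" "v \<in> V" for i j u v
    by (rule isometry_common[OF f that])
  show "card (pverts H) = card (pverts G)" by (simp add: pG pH card_image inj)
  have "{graph_dist H u v | u v. u \<in> f ` V \<and> v \<in> f ` V} = {graph_dist G u v | u v. u \<in> V \<and> v \<in> V}"
    by (auto simp: dist) (metis dist imageI)+
  then show diam: "graph_diam H = graph_diam G" by (simp add: graph_diam_def pG pH)
  show "DDR H = DDR G"
    unfolding G_def H_def V.DDR_iff W.DDR_iff distance_degree_regular_def
    by (simp add: W isometry_card_sphere[OF f, unfolded W])
  have com: "commuting W E i j = commuting V D i j" for i j
    by (simp add: commuting_def W common[unfolded W])
  show "one_CDDR H = one_CDDR G" "CDDR H = CDDR G"
    by (simp_all add: G_def H_def V.one_CDDR_iff W.one_CDDR_iff V.CDDR_iff W.CDDR_iff com)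
  have "mean_intersection H h i j (f u) = mean_intersection G h i j u" if "u \<in> V" for h i j u
    unfolding G_def H_def V.mean_intersection_eq[OF that]
    using W.mean_intersection_eq[of "f u"] isometry_card_sphere[OF f that]
      isometry_sum_common[OF f that] that by (simp add: W del: of_nat_sum)
  then show "DMR H = DMR G" by (simp add: DMR_def pG pH diam)
  show "DWR H = DWR G" by (simp add: DWR_def pG pH dist walk)
qed

lemma geodesic_space_relabel:
  assumes "geodesic_space V D" and inj: "inj_on f V"
  defines "E \<equiv> \<lambda>x y. D (inv_into V f x) (inv_into V f y)"
  shows "geodesic_space (f ` V) E" "isometry V D (f ` V) E f"
proof -
  interpret geodesic_space V D by fact
  have E: "E (f x) (f y) = D x y" if "x \<in> V" "y \<in> V" for x y using inj that by (simp add: E_def)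
  show "isometry V D (f ` V) E f" using inj by (simp add: isometry_def bij_betw_def E)
  show "geodesic_space (f ` V) E"
  proof
    show "E u v = 0 \<longleftrightarrow> u = v" if "u \<in> f ` V" "v \<in> f ` V" for u v
      using that inj by (auto simp: E dist_0)
    show "E u v = E v u" if "u \<in> f ` V" "v \<in> f ` V" for u v
      using that by (auto simp: E dist_sym)
    show "E u v \<le> Suc (E w v)" if "u \<in> f ` V" "w \<in> f ` V" "v \<in> f ` V" "E u w = 1" for u v w
      using that by (auto simp: E dist_step)
    show "\<exists>w\<in>f ` V. E u w = 1 \<and> E w v = k" if "u \<in> f ` V" "v \<in> f ` V" "E u v = Suc k" for u v k
      using that dist_descend by (auto simp: E)
  qed (use finite_V nonempty_V in auto)
qed

text \<open>
  The constructions below change the vertex type; finiteness allows a return to natural numbers at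
  the end.
\<close>

lemma nat_copy:
  assumes "geodesic_space V D"
  shows "\<exists>H :: nat pair_pre_digraph. connected_simple_graph H \<and>
    card (pverts H) = card V \<and> graph_diam H = graph_diam (graph_of V D) \<and>
    DDR H = DDR (graph_of V D) \<and> one_CDDR H = one_CDDR (graph_of V D) \<and>
    CDDR H = CDDR (graph_of V D) \<and> DMR H = DMR (graph_of V D) \<and> DWR H = DWR (graph_of V D)"
proof -
  interpret geodesic_space V D by fact
  obtain f :: "'a \<Rightarrow> nat" where f: "inj_on f V"
    using finite_imp_inj_to_nat_seg[OF finite_V] by blast
  define E where "E = (\<lambda>x y. D (inv_into V f x) (inv_into V f y))"
  have E: "geodesic_space (f ` V) E" "isometry V D (f ` V) E f"
    using geodesic_space_relabel[OF assms f] by (simp_all add: E_def)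
  show ?thesis
    using isometry_graph_properties[OF assms E] geodesic_space.connected_simple_graph[OF E(1)]
    by (intro exI[of _ "graph_of (f ` V) E"]) (simp add: pverts_graph_of)
qed

section \<open>Cartesian products\<close>

definition product_dist ::
  "('a \<Rightarrow> 'a \<Rightarrow> nat) \<Rightarrow> ('b \<Rightarrow> 'b \<Rightarrow> nat) \<Rightarrow> 'a \<times> 'b \<Rightarrow> 'a \<times> 'b \<Rightarrow> nat" where
  "product_dist D E x y = D (fst x) (fst y) + E (snd x) (snd y)"

lemma product_dist_Pair [simp]: "product_dist D E (a, b) (a', b') = D a a' + E b b'"
  by (simp add: product_dist_def)

text \<open>
  A sphere of a Cartesian product is the disjoint union of products of spheres. Applied to two
  spheres at once, this turns the counts \<open>common\<close> of a product into a convolution of the counts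
  of the factors.
\<close>

lemma card_split_sums:
  assumes "finite V" "finite W"
  shows "card {(x, y) \<in> V \<times> W. f x + f' y = (k::nat) \<and> g x + g' y = (l::nat)} =
    (\<Sum>i\<le>k. \<Sum>j\<le>l. card {x \<in> V. f x = i \<and> g x = j} * card {y \<in> W. f' y = k - i \<and> g' y = l - j})"
    (is "card ?S = _")
proof -
  let ?A = "\<lambda>(i, j). {x \<in> V. f x = i \<and> g x = j} \<times> {y \<in> W. f' y = k - i \<and> g' y = l - j}"
  have "?S = (\<Union>p\<in>{..k} \<times> {..l}. ?A p)" by auto
  moreover have "card (\<Union>p\<in>{..k} \<times> {..l}. ?A p) = (\<Sum>p\<in>{..k} \<times> {..l}. card (?A p))"
    by (rule card_UN_disjoint) (use assms in auto)
  ultimately show ?thesis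
    by (simp add: sum.cartesian_product card_cartesian_product case_prod_unfold)
qed

lemma common_product:
  assumes "finite V" "finite W"
  shows "common (V \<times> W) (product_dist D E) k l (a, b) (a', b') =
    (\<Sum>i\<le>k. \<Sum>j\<le>l. common V D i j a a' * common W E (k - i) (l - j) b b')"
  unfolding common_def card_split_sums[OF assms, symmetric]
  by (rule arg_cong[where f = card]) auto

lemma common_diagonal: "common V D i j a a = (if i = j then card (sphere V D i a) else 0)"
proof (cases "i = j")
  case False
  then have "{w \<in> V. D a w = i \<and> D a w = j} = {}" by auto
  then show ?thesis using False by (simp only: common_def card.empty if_False)
qed (simp add: common_def sphere_def)

locale geodesic_product = V: geodesic_space V D + W: geodesic_space W E
  for V :: "'a set" and D and W :: "'b set" and E
begin

abbreviation "VW \<equiv> V \<times> W"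
abbreviation "DE \<equiv> product_dist D E"

lemma geodesic: "geodesic_space VW DE"
proof
  show "finite VW" "VW \<noteq> {}" using V.finite_V W.finite_V V.nonempty_V W.nonempty_V by auto
  show "DE u v = 0 \<longleftrightarrow> u = v" if "u \<in> VW" "v \<in> VW" for u v
    using that by (auto simp: V.dist_0 W.dist_0)
  show "DE u v = DE v u" if "u \<in> VW" "v \<in> VW" for u v
    using that by (auto simp: V.dist_sym W.dist_sym)
  show "DE u v \<le> Suc (DE w v)" if "u \<in> VW" "w \<in> VW" "v \<in> VW" "DE u w = 1" for u w v
  proof -
    obtain a b c d x y where eqs: "u = (a, b)" "w = (c, d)" "v = (x, y)"
      by (cases u, cases w, cases v)
    have V: "a \<in> V" "c \<in> V" "x \<in> V" and W: "b \<in> W" "d \<in> W" "y \<in> W" using that eqs by auto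
    have "D a c = 0 \<and> E b d = 1 \<or> D a c = 1 \<and> E b d = 0" using that eqs by auto
    then show ?thesis
    proof
      assume "D a c = 0 \<and> E b d = 1"
      then show ?thesis using V W eqs V.dist_0[of a c] W.dist_step[of b d y] by simp
    next
      assume "D a c = 1 \<and> E b d = 0"
      then show ?thesis using V W eqs W.dist_0[of b d] V.dist_step[of a c x] by simp
    qed
  qed
  show "\<exists>w\<in>VW. DE u w = 1 \<and> DE w v = k" if "u \<in> VW" "v \<in> VW" "DE u v = Suc k" for u v k
  proof -
    obtain a b x y where eqs: "u = (a, b)" "v = (x, y)" by (cases u, cases v)
    have V: "a \<in> V" "x \<in> V" and W: "b \<in> W" "y \<in> W" using that eqs by auto
    show ?thesis
    proof (cases "D a x")
      case 0
      then have "E b y = Suc k" using that eqs by simp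
      then obtain z where "z \<in> W" "E b z = 1" "E z y = k" using W.dist_descend W by blast
      then show ?thesis using 0 V W eqs by (intro bexI[of _ "(a, z)"]) auto
    next
      case (Suc n)
      then obtain z where "z \<in> V" "D a z = 1" "D z x = n" using V.dist_descend V by blast
      then show ?thesis using Suc V W eqs that by (intro bexI[of _ "(z, b)"]) auto
    qed
  qed
qed

lemma common_eq:
  "common VW DE k l (a, b) (a', b') =
    (\<Sum>i\<le>k. \<Sum>j\<le>l. common V D i j a a' * common W E (k - i) (l - j) b b')"
  by (rule common_product[OF V.finite_V W.finite_V])

lemma commuting_1:
  assumes "\<And>j. commuting V D 1 j" "\<And>j. commuting W E 1 j"
  shows "commuting VW DE 1 l"
  unfolding commuting_def
proof (clarify)
  fix a b a' b' assume in_VW: "a \<in> V" "b \<in> W" "a' \<in> V" "b' \<in> W"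
  have "common V D i j a a' = common V D i j a' a" if "i \<le> 1" for i j
    using assms(1)[of j] V.commuting_0[of j] in_VW that by (cases i) (auto simp: commuting_def)
  moreover have "common W E (1 - i) j b b' = common W E (1 - i) j b' b" for i j
    using assms(2)[of j] W.commuting_0[of j] in_VW by (cases i) (auto simp: commuting_def)
  ultimately show "common VW DE 1 l (a, b) (a', b') = common VW DE 1 l (a', b') (a, b)"
    unfolding common_eq by (intro sum.cong refl arg_cong2[where f = "(*)"]) auto
qed

text \<open>
  Look at two vertices that agree in the second coordinate. Of the terms of the convolution
  only those with equal index in the second factor survive, and all but the leading one
  (index \<open>0\<close> there) are symmetric because the smaller index pairs commute. So the first failure of
  commutation in one factor persists in the product, whatever the other factor is.
\<close>

lemma not_commuting:
  assumes not: "\<not> commuting V D k l"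
    and less: "\<And>s. 0 < s \<Longrightarrow> s \<le> k \<Longrightarrow> s \<le> l \<Longrightarrow> commuting V D (k - s) (l - s)"
  shows "\<not> commuting VW DE k l"
proof
  assume com: "commuting VW DE k l"
  obtain a a' where a: "a \<in> V" "a' \<in> V" "common V D k l a a' \<noteq> common V D k l a' a"
    using not by (auto simp: commuting_def)
  obtain b where b: "b \<in> W" using W.nonempty_V by blast
  let ?c = "\<lambda>x y i j. common V D i j x y * common W E (k - i) (l - j) b b"
  have c: "?c a a' i j = ?c a' a i j" if "(i, j) \<in> {..k} \<times> {..l} - {(k, l)}" for i j
  proof (cases "k - i = l - j")
    case True
    with that have "0 < k - i" "k - i \<le> k" "k - i \<le> l" "k - (k - i) = i" "l - (k - i) = j" by auto
    with less[of "k - i"] a have "common V D i j a a' = common V D i j a' a"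
      by (simp add: commuting_def)
    then show ?thesis by simp
  qed (simp add: common_diagonal)
  have split: "common VW DE k l (x, b) (y, b)
      = ?c x y k l + (\<Sum>(i, j)\<in>{..k} \<times> {..l} - {(k, l)}. ?c x y i j)" for x y
    unfolding common_eq sum.cartesian_product by (subst sum.remove[of _ "(k, l)"]) auto
  have "common VW DE k l (a, b) (a', b) = common VW DE k l (a', b) (a, b)"
    using com a b unfolding commuting_def by blast
  moreover have "(\<Sum>(i, j)\<in>{..k} \<times> {..l} - {(k, l)}. ?c a a' i j)
      = (\<Sum>(i, j)\<in>{..k} \<times> {..l} - {(k, l)}. ?c a' a i j)"
    by (intro sum.cong refl, unfold case_prod_unfold, rule c) auto
  ultimately have "?c a a' k l = ?c a' a k l" by (simp add: split)
  then show False using a b by (simp add: W.common_0)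
qed

lemma distance_degree_regular:
  assumes "distance_degree_regular V D" "distance_degree_regular W E"
  shows "distance_degree_regular VW DE"
  unfolding distance_degree_regular_def
proof (intro allI ballI)
  fix k u v assume "u \<in> VW" "v \<in> VW"
  then obtain a b a' b' where uv: "u = (a, b)" "v = (a', b')" "a \<in> V" "b \<in> W" "a' \<in> V" "b' \<in> W"
    by auto
  have "common V D i j a a = common V D i j a' a'" for i j
    using assms(1) uv unfolding common_diagonal distance_degree_regular_def by metis
  moreover have "common W E i j b b = common W E i j b' b'" for i j
    using assms(2) uv unfolding common_diagonal distance_degree_regular_def by metis
  ultimately have "common VW DE k k u u = common VW DE k k v v"
    by (simp add: uv common_eq)
  then show "card (sphere VW DE k u) = card (sphere VW DE k v)" by (simp add: common_diagonal)
qed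

lemma homogeneous:
  assumes "homogeneous V D" "homogeneous W E" shows "homogeneous VW DE"
  unfolding homogeneous_def
proof (clarify)
  fix a b a' b' assume "a \<in> V" "b \<in> W" "a' \<in> V" "b' \<in> W"
  with assms obtain f g where f: "isometry V D V D f" "f a = a'" and g: "isometry W E W E g" "g b = b'"
    unfolding homogeneous_def by blast
  have "bij_betw (map_prod f g) VW VW" using f g by (auto simp: isometry_def bij_betw_map_prod)
  with f g have "isometry VW DE VW DE (map_prod f g)" by (auto simp: isometry_def)
  with f g show "\<exists>h. isometry VW DE VW DE h \<and> h (a, b) = (a', b')"
    by (intro exI[of _ "map_prod f g"]) simp
qed

lemma edges_in_triangles:
  assumes "edges_in_triangles V D" "edges_in_triangles W E"
  shows "edges_in_triangles VW DE"
  unfolding edges_in_triangles_def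
proof (intro conjI ballI impI)
  fix u assume "u \<in> VW"
  then obtain a b where u: "u = (a, b)" "a \<in> V" "b \<in> W" by auto
  then obtain a' where "a' \<in> V" "D a a' = 1" using assms(1) unfolding edges_in_triangles_def by blast
  then show "\<exists>v\<in>VW. DE u v = 1" using u by (intro bexI[of _ "(a', b)"]) auto
next
  fix u v assume "u \<in> VW" "v \<in> VW" and uv: "DE u v = 1"
  then obtain a b a' b' where eqs: "u = (a, b)" "v = (a', b')" and V: "a \<in> V" "a' \<in> V"
    and W: "b \<in> W" "b' \<in> W" by auto
  have "D a a' = 0 \<and> E b b' = 1 \<or> D a a' = 1 \<and> E b b' = 0" using uv eqs by auto
  then show "\<exists>w\<in>VW. DE u w = 1 \<and> DE w v = 1"
  proof
    assume *: "D a a' = 0 \<and> E b b' = 1"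
    then obtain z where "z \<in> W" "E b z = 1" "E z b' = 1"
      using assms(2) W unfolding edges_in_triangles_def by blast
    with * show ?thesis using V eqs by (intro bexI[of _ "(a, z)"]) auto
  next
    assume *: "D a a' = 1 \<and> E b b' = 0"
    then obtain z where "z \<in> V" "D a z = 1" "D z a' = 1"
      using assms(1) V unfolding edges_in_triangles_def by blast
    with * show ?thesis using W eqs by (intro bexI[of _ "(z, b)"]) auto
  qed
qed

text \<open>
  The three edges of a triangle of a product run in the same factor.
\<close>

lemma triangle_count:
  assumes a: "a \<in> V" and b: "b \<in> W"
  shows "triangle_count VW DE (a, b) = triangle_count V D a + triangle_count W E b"
proof -
  have sphere: "sphere VW DE 1 (a, b) = (\<lambda>x. (x, b)) ` sphere V D 1 a \<union> Pair a ` sphere W E 1 b"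
    (is "_ = ?A \<union> ?B")
  proof -
    have "D a x + E b y = Suc 0 \<longleftrightarrow> D a x = 1 \<and> y = b \<or> x = a \<and> E b y = 1" if "x \<in> V" "y \<in> W" for x y
      using V.dist_0[OF a, of x] W.dist_0[OF b, of y] that by (cases "x = a"; cases "y = b") auto
    then show ?thesis using a b unfolding sphere_def by auto
  qed
  have fin: "finite ?A" "finite ?B" using V.finite_V W.finite_V by (simp_all add: sphere_def)
  have disj: "?A \<inter> ?B = {}" using a V.dist_refl by (auto simp: sphere_def)
  have A: "common VW DE 1 1 (a, b) (x, b) = common V D 1 1 a x" if "x \<in> sphere V D 1 a" for x
  proof -
    have "x \<in> V" "D a x = 1" using that by (auto simp: sphere_def)
    then show ?thesis using a b by (simp add: common_eq V.common_0 common_diagonal W.sphere_0)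
  qed
  have B: "common VW DE 1 1 (a, b) (a, y) = common W E 1 1 b y" if "y \<in> sphere W E 1 b" for y
  proof -
    have "y \<in> W" "E b y = 1" using that by (auto simp: sphere_def)
    then show ?thesis using a b by (simp add: common_eq W.common_0 common_diagonal V.sphere_0)
  qed
  have "triangle_count VW DE (a, b) = (\<Sum>v\<in>?A. common VW DE 1 1 (a, b) v) + (\<Sum>v\<in>?B. common VW DE 1 1 (a, b) v)"
    unfolding triangle_count_def sphere by (rule sum.union_disjoint[OF fin disj])
  also have "(\<Sum>v\<in>?A. common VW DE 1 1 (a, b) v) = triangle_count V D a"
    by (subst sum.reindex) (auto simp: inj_on_def triangle_count_def A[unfolded One_nat_def] intro!: sum.cong)
  also have "(\<Sum>v\<in>?B. common VW DE 1 1 (a, b) v) = triangle_count W E b"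
    by (subst sum.reindex) (auto simp: inj_on_def triangle_count_def B[unfolded One_nat_def] intro!: sum.cong)
  finally show ?thesis .
qed

text \<open>
  An edge in a triangle of the first factor stays in a triangle, whereas an edge of the second
  factor without common neighbours acquires none.
\<close>

lemma not_DWR:
  assumes tri: "edges_in_triangles V D"
    and y: "y \<in> W" "y' \<in> W" "E y y' = 1" and no: "\<And>z. z \<in> W \<Longrightarrow> E y z = 1 \<Longrightarrow> E z y' = 1 \<Longrightarrow> False"
  shows "\<not> DWR (graph_of VW DE)"
proof -
  interpret P: geodesic_space VW DE by (rule geodesic)
  obtain a where a: "a \<in> V" using V.nonempty_V by blast
  then obtain b where b: "b \<in> V" "D a b = 1" using tri unfolding edges_in_triangles_def by blast
  then obtain c where c: "c \<in> V" "D a c = 1" "D c b = 1"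
    using tri a unfolding edges_in_triangles_def by blast
  show ?thesis
  proof (rule P.not_DWR[of "(a, y)" "(b, y)" "(c, y)" "(a, y)" "(a, y')"])
    fix z assume z: "z \<in> VW" "DE (a, y) z = 1" "DE z (a, y') = 1"
    obtain p q where pq: "z = (p, q)" "p \<in> V" "q \<in> W" using z by auto
    have sum: "D a p + E y q = 1" "D a p + E q y' = 1" using z pq a V.dist_sym[of a p] by simp_all
    show False
    proof (cases "D a p")
      case 0 then show ?thesis using no sum pq by auto
    next
      case (Suc n)
      then have "E y q = 0" "E q y' = 0" using sum by auto
      then show ?thesis using y pq W.dist_0 by auto
    qed
  qed (use a b c y in auto)
qed

end

section \<open>Doubling every vertex\<close>

text \<open>
  Every vertex is replaced by two adjacent copies of itself. Then each edge lies in a triangle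
  with a copy of one of its ends, and the distance matrices become \<open>A\<^sub>j \<otimes> J\<close> for \<open>j \<ge> 2\<close> and
  \<open>A\<^sub>1 \<otimes> J + I \<otimes> (J - I)\<close> for \<open>j = 1\<close>, where \<open>J\<close> is the all-ones matrix of size two. The
  commutation relations stay the same.
\<close>

definition twin_dist :: "('a \<Rightarrow> 'a \<Rightarrow> nat) \<Rightarrow> 'a \<times> bool \<Rightarrow> 'a \<times> bool \<Rightarrow> nat" where
  "twin_dist D u v = (if fst u = fst v then of_bool (snd u \<noteq> snd v) else D (fst u) (fst v))"

lemma twin_dist_Pair: "twin_dist D (a, x) (b, y) = (if a = b then of_bool (x \<noteq> y) else D a b)"
  by (simp add: twin_dist_def)

context geodesic_space
begin

abbreviation "twin_V \<equiv> V \<times> (UNIV :: bool set)"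
abbreviation "twin_D \<equiv> twin_dist D"

lemma geodesic_twin: "geodesic_space twin_V twin_D"
proof
  show "finite twin_V" "twin_V \<noteq> {}" using finite_V nonempty_V by auto
  show "twin_D u v = 0 \<longleftrightarrow> u = v" if "u \<in> twin_V" "v \<in> twin_V" for u v
    using that by (cases u; cases v) (auto simp: twin_dist_Pair dist_0)
  show "twin_D u v = twin_D v u" if "u \<in> twin_V" "v \<in> twin_V" for u v
    using that by (cases u; cases v) (auto simp: twin_dist_Pair dist_sym)
  show "twin_D u v \<le> Suc (twin_D w v)"
    if "u \<in> twin_V" "w \<in> twin_V" "v \<in> twin_V" "twin_D u w = 1" for u w v
  proof -
    obtain a x b y c z where eqs: "u = (a, x)" "w = (c, z)" "v = (b, y)" by (cases u; cases w; cases v)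
    have "a \<in> V" "b \<in> V" "c \<in> V" using that eqs by auto
    then show ?thesis using that(4) dist_step[of a c b] unfolding eqs
      by (auto simp: twin_dist_Pair of_bool_def split: if_splits)
  qed
  show "\<exists>w\<in>twin_V. twin_D u w = 1 \<and> twin_D w v = k"
    if "u \<in> twin_V" "v \<in> twin_V" "twin_D u v = Suc k" for u v k
  proof -
    obtain a x b y where eqs: "u = (a, x)" "v = (b, y)" by (cases u; cases v)
    have V: "a \<in> V" "b \<in> V" using that eqs by auto
    show ?thesis
    proof (cases "a = b")
      case True
      then have "k = 0" "x \<noteq> y" using that(3) eqs
        by (auto simp: twin_dist_Pair of_bool_def split: if_splits)
      then show ?thesis using True V eqs by (intro bexI[of _ "(b, y)"]) (auto simp: twin_dist_Pair)
    next
      case False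
      then have "D a b = Suc k" using that(3) eqs by (simp add: twin_dist_Pair)
      then obtain c where c: "c \<in> V" "D a c = 1" "D c b = k" using dist_descend V by blast
      then have "a \<noteq> c" using V by auto
      then show ?thesis using False V c eqs dist_0[of c b]
        by (intro bexI[of _ "(c, y)"]) (auto simp: twin_dist_Pair)
    qed
  qed
qed

lemma edges_in_triangles_twin:
  assumes "\<And>u. u \<in> V \<Longrightarrow> \<exists>v\<in>V. v \<noteq> u"
  shows "edges_in_triangles twin_V twin_D"
  unfolding edges_in_triangles_def
proof (intro conjI ballI impI)
  fix u assume "u \<in> twin_V"
  then show "\<exists>v\<in>twin_V. twin_D u v = 1"
    by (intro bexI[of _ "(fst u, \<not> snd u)"]) (auto simp: twin_dist_def)
next
  fix u v assume "u \<in> twin_V" "v \<in> twin_V" and uv: "twin_D u v = 1"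
  then obtain a x b y where eqs: "u = (a, x)" "v = (b, y)" and V: "a \<in> V" "b \<in> V" by auto
  show "\<exists>w\<in>twin_V. twin_D u w = 1 \<and> twin_D w v = 1"
  proof (cases "a = b")
    case True
    obtain c where "c \<in> V" "D a c = 1"
    proof -
      obtain d where d: "d \<in> V" "d \<noteq> a" using assms V by blast
      then obtain k where "D a d = Suc k" using dist_0[of a d] V by (cases "D a d") auto
      then show ?thesis using dist_descend[of a d k] d V that by blast
    qed
    moreover from this have "a \<noteq> c" using V by auto
    ultimately show ?thesis using True V eqs dist_sym[of a c]
      by (intro bexI[of _ "(c, y)"]) (auto simp: twin_dist_Pair)
  next
    case False
    then show ?thesis using V eqs uv by (intro bexI[of _ "(a, \<not> x)"]) (auto simp: twin_dist_Pair)
  qed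
qed

lemma homogeneous_twin:
  assumes "homogeneous V D" shows "homogeneous twin_V twin_D"
  unfolding homogeneous_def
proof (clarify)
  fix a b and x y :: bool assume "a \<in> V" "b \<in> V"
  with assms obtain f where f: "isometry V D V D f" "f a = b" unfolding homogeneous_def by blast
  let ?g = "\<lambda>z. z = (x = y)"
  have "bij_betw (map_prod f ?g) twin_V twin_V"
    by (rule bij_betw_map_prod) (use f in \<open>auto simp: isometry_def bij_betw_def inj_on_def\<close>)
  moreover have "f c = f d \<longleftrightarrow> c = d" if "c \<in> V" "d \<in> V" for c d
    using f that by (auto simp: isometry_def bij_betw_def inj_on_eq_iff)
  ultimately have "isometry twin_V twin_D twin_V twin_D (map_prod f ?g)"
    using f by (auto simp: isometry_def twin_dist_Pair)
  then show "\<exists>h. isometry twin_V twin_D twin_V twin_D h \<and> h (a, x) = (b, y)"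
    using f by (intro exI[of _ "map_prod f ?g"]) auto
qed

lemma twin_dist_eq_ge_2:
  "a \<in> V \<Longrightarrow> b \<in> V \<Longrightarrow> 2 \<le> i \<Longrightarrow> twin_D (a, x) (b, y) = i \<longleftrightarrow> D a b = i"
  by (auto simp: twin_dist_Pair)

text \<open>
  The correction term counts the other copy of \<open>(a, x)\<close>, a neighbour that does not come from a
  neighbour of \<open>a\<close>.
\<close>

lemma common_twin:
  assumes V: "a \<in> V" "b \<in> V" and ij: "1 \<le> i" "2 \<le> j"
  shows "common twin_V twin_D i j (a, x) (b, y) = 2 * common V D i j a b + of_bool (i = 1 \<and> D a b = j)"
proof -
  let ?S = "{c \<in> V. D a c = i \<and> D b c = j}"
  let ?R = "if i = 1 \<and> D a b = j then {(a, \<not> x)} else {}"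
  have i: "twin_D (a, x) (c, z) = i \<longleftrightarrow> D a c = i \<or> i = 1 \<and> c = a \<and> z = (\<not> x)" if "c \<in> V" for c z
    using that V ij(1) by (auto simp: twin_dist_Pair of_bool_def split: if_splits)
  have "{w \<in> twin_V. twin_D (a, x) w = i \<and> twin_D (b, y) w = j} = ?S \<times> UNIV \<union> ?R"
  proof (rule set_eqI)
    fix w :: "'a \<times> bool"
    obtain c z where w: "w = (c, z)" by (cases w)
    show "w \<in> {w \<in> twin_V. twin_D (a, x) w = i \<and> twin_D (b, y) w = j} \<longleftrightarrow> w \<in> ?S \<times> UNIV \<union> ?R"
    proof (cases "c \<in> V")
      case True
      from i[OF this, of z] twin_dist_eq_ge_2[OF V(2) this ij(2), of y z] show ?thesis
        using V True dist_sym[of b a] by (auto simp: w)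
    qed (use w V in auto)
  qed
  moreover have "card (?S \<times> (UNIV :: bool set) \<union> ?R) = card (?S \<times> (UNIV :: bool set)) + card ?R"
    by (rule card_Un_disjoint) (use finite_V V in auto)
  ultimately show ?thesis by (simp add: common_def card_cartesian_product)
qed

lemma commuting_twin: "commuting twin_V twin_D i j \<longleftrightarrow> commuting V D i j"
proof -
  interpret T: geodesic_space twin_V twin_D by (rule geodesic_twin)
  have main: "commuting twin_V twin_D i j \<longleftrightarrow> commuting V D i j" if "1 \<le> i" "2 \<le> j" for i j
  proof -
    have "common twin_V twin_D i j (a, x) (b, y) = common twin_V twin_D i j (b, y) (a, x) \<longleftrightarrow>
        common V D i j a b = common V D i j b a" if "a \<in> V" "b \<in> V" for a b x y
      using that \<open>1 \<le> i\<close> \<open>2 \<le> j\<close> by (simp add: common_twin dist_sym[of b a])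
    then show ?thesis unfolding commuting_def by auto
  qed
  consider "i = 0 \<or> j = 0" | "i = j" | "1 \<le> i" "2 \<le> j" | "1 \<le> j" "2 \<le> i" by linarith
  then show ?thesis
  proof cases
    case 1 then show ?thesis
      using commuting_0[of i] T.commuting_0[of i] commuting_swap[of i 0] T.commuting_swap[of i 0]
        commuting_0[of j] T.commuting_0[of j] by auto
  next
    case 2 then show ?thesis using commuting_same T.commuting_same by simp
  next
    case 3 then show ?thesis by (rule main)
  next
    case 4 then show ?thesis
      using main[of j i] commuting_swap[of i j] T.commuting_swap[of i j] by simp
  qed
qed

end

section \<open>Hypercubes\<close>

text \<open>
  The hypercube serves to enlarge size and diameter: it has an automorphism exchanging any two
  given vertices, so all its distance matrices commute. The one-dimensional cube is a single edge.
\<close>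

definition cube_dist :: "nat set \<Rightarrow> nat set \<Rightarrow> nat" where
  "cube_dist A B = card ((A - B) \<union> (B - A))"

lemma cube_dist_step: 
  assumes "finite A" "finite B" "finite C"
  shows "cube_dist A B \<le> cube_dist A C + cube_dist C B"
proof -
  have "cube_dist A B \<le> card ((A - C \<union> (C - A)) \<union> (C - B \<union> (B - C)))"
    unfolding cube_dist_def by (rule card_mono) (use assms in auto)
  also have "\<dots> \<le> cube_dist A C + cube_dist C B"
    unfolding cube_dist_def by (rule card_Un_le)
  finally show ?thesis .
qed

lemma geodesic_cube: "geodesic_space (Pow {..<m}) cube_dist"
proof
  show "finite (Pow {..<m})" "Pow {..<m} \<noteq> {}" by auto
  have fin: "finite A" if "A \<in> Pow {..<m}" for A using that finite_subset by blast
  show "cube_dist u v = 0 \<longleftrightarrow> u = v" if "u \<in> Pow {..<m}" "v \<in> Pow {..<m}" for u v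
    using fin that by (auto simp: cube_dist_def)
  show "cube_dist u v = cube_dist v u" if "u \<in> Pow {..<m}" "v \<in> Pow {..<m}" for u v
    by (simp add: cube_dist_def Un_commute)
  show "cube_dist u v \<le> Suc (cube_dist w v)"
    if "u \<in> Pow {..<m}" "w \<in> Pow {..<m}" "v \<in> Pow {..<m}" "cube_dist u w = 1" for u w v
    using cube_dist_step[of u v w] that fin by simp
  show "\<exists>w\<in>Pow {..<m}. cube_dist u w = 1 \<and> cube_dist w v = k"
    if uv: "u \<in> Pow {..<m}" "v \<in> Pow {..<m}" "cube_dist u v = Suc k" for u v k
  proof -
    obtain x where x: "x \<in> (u - v) \<union> (v - u)" using uv(3)
      by (metis card.empty cube_dist_def equals0I nat.distinct(1))
    let ?w = "(u - {x}) \<union> ({x} - u)"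
    have "(u - ?w) \<union> (?w - u) = {x}" by auto
    moreover have "(?w - v) \<union> (v - ?w) = ((u - v) \<union> (v - u)) - {x}" using x by auto
    ultimately have "cube_dist u ?w = 1" "cube_dist ?w v = cube_dist u v - 1"
      unfolding cube_dist_def using x by (simp_all only: card_Diff_singleton) simp
    moreover have "?w \<in> Pow {..<m}" using x uv by auto
    ultimately show ?thesis using uv(3) by (intro bexI[of _ ?w]) simp_all
  qed
qed

lemma cube_swap:
  assumes "u \<in> Pow {..<m}" "v \<in> Pow {..<m}"
  shows "\<exists>f. isometry (Pow {..<m}) cube_dist (Pow {..<m}) cube_dist f \<and> f u = v \<and> f v = u"
proof -
  \<comment> \<open>translation by \<open>s\<close> in the group of subsets under symmetric difference\<close>
  define s where "s = (u - v) \<union> (v - u)"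
  define f where "f A = (A - s) \<union> (s - A)" for A
  have "f (f A) = A" for A by (auto simp: f_def)
  moreover have "f A \<in> Pow {..<m}" if "A \<in> Pow {..<m}" for A
    using that assms by (auto simp: f_def s_def)
  ultimately have "bij_betw f (Pow {..<m}) (Pow {..<m})"
    by (intro bij_betw_byWitness[where f' = f]) auto
  moreover have "cube_dist (f A) (f B) = cube_dist A B" for A B
    unfolding cube_dist_def by (rule arg_cong[where f = card]) (auto simp: f_def)
  moreover have "f u = v" "f v = u" by (auto simp: f_def s_def)
  ultimately show ?thesis unfolding isometry_def by blast
qed

lemma homogeneous_cube: "homogeneous (Pow {..<m}) cube_dist"
  unfolding homogeneous_def
proof (intro ballI)
  fix u v assume "u \<in> Pow {..<m}" "v \<in> Pow {..<m}"
  from cube_swap[OF this]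
  show "\<exists>f. isometry (Pow {..<m}) cube_dist (Pow {..<m}) cube_dist f \<and> f u = v" by blast
qed

lemma commuting_cube: "commuting (Pow {..<m}) cube_dist i j"
  unfolding commuting_def
proof (intro ballI)
  fix u v assume uv: "u \<in> Pow {..<m}" "v \<in> Pow {..<m}"
  from cube_swap[OF this]
  obtain f where f: "isometry (Pow {..<m}) cube_dist (Pow {..<m}) cube_dist f" "f u = v" "f v = u"
    by blast
  from isometry_common[OF f(1) uv, of i j]
  show "common (Pow {..<m}) cube_dist i j u v = common (Pow {..<m}) cube_dist i j v u"
    unfolding f(2,3) by simp
qed

section \<open>Reduction to one vertex\<close>

text \<open>
  In a vertex-transitive graph it suffices to inspect one vertex. This keeps the finite
  verifications for the two Cayley graphs small.
\<close>

lemma geodesic_space_from_vertex: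
  assumes fin: "finite V" and e: "e \<in> V" and hom: "homogeneous V D"
    and zero: "\<And>v. v \<in> V \<Longrightarrow> D e v = 0 \<longleftrightarrow> v = e"
    and symm: "\<And>v. v \<in> V \<Longrightarrow> D e v = D v e"
    and step: "\<And>w v. w \<in> V \<Longrightarrow> v \<in> V \<Longrightarrow> D e w = 1 \<Longrightarrow> D e v \<le> Suc (D w v)"
    and descend: "\<And>v. v \<in> V \<Longrightarrow> D e v = 0 \<or> (\<exists>w\<in>V. D e w = 1 \<and> Suc (D w v) = D e v)"
  shows "geodesic_space V D"
proof -
  have move: "\<exists>f. bij_betw f V V \<and> (\<forall>x\<in>V. \<forall>y\<in>V. D (f x) (f y) = D x y) \<and> f u = e" if "u \<in> V" for u
    using hom e that unfolding homogeneous_def isometry_def by blast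
  show ?thesis
  proof
    show "finite V" "V \<noteq> {}" using fin e by auto
  next
    fix u v assume uv: "u \<in> V" "v \<in> V"
    obtain f where f: "bij_betw f V V" "\<And>x y. x \<in> V \<Longrightarrow> y \<in> V \<Longrightarrow> D (f x) (f y) = D x y" "f u = e"
      using move[OF uv(1)] by blast
    have fV: "f x \<in> V" if "x \<in> V" for x using f(1) that by (auto simp: bij_betw_def)
    have from_u: "D u x = D e (f x)" if "x \<in> V" for x
      using f(2)[OF uv(1) that] unfolding f(3) by (rule sym)
    have to_v: "D x v = D (f x) (f v)" if "x \<in> V" for x
      using f(2)[OF that uv(2)] by (rule sym)
    have inj: "f v = f u \<longleftrightarrow> v = u"
      using f(1) uv unfolding bij_betw_def by (metis inj_on_eq_iff)
    have "D u v = 0 \<longleftrightarrow> f v = f u"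
      unfolding from_u[OF uv(2)] f(3) by (rule zero[OF fV[OF uv(2)]])
    then show "D u v = 0 \<longleftrightarrow> u = v" unfolding inj by (simp only: eq_commute[of v u])
    have "D v u = D (f v) e" using f(2)[OF uv(2,1)] unfolding f(3) by (rule sym)
    then show "D u v = D v u" unfolding from_u[OF uv(2)] using symm[OF fV[OF uv(2)]] by (simp only:)
    show "D u v \<le> Suc (D w v)" if w: "w \<in> V" "D u w = 1" for w
      unfolding from_u[OF uv(2)] to_v[OF w(1)]
      by (rule step[OF fV[OF w(1)] fV[OF uv(2)]]) (use w from_u[OF w(1)] in \<open>simp only:\<close>)
    show "\<exists>w\<in>V. D u w = 1 \<and> D w v = k" if k: "D u v = Suc k" for k
    proof -
      have "D e (f v) = Suc k" using k from_u[OF uv(2)] by (simp only:)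
      then obtain w where w: "w \<in> V" "D e w = 1" "D w (f v) = k"
        using descend[OF fV[OF uv(2)]] by auto
      obtain w' where w': "w' \<in> V" "f w' = w"
        using f(1) w(1) unfolding bij_betw_def by (metis imageE)
      show ?thesis
        by (rule bexI[OF _ w'(1)], unfold from_u[OF w'(1)] to_v[OF w'(1)] w'(2)) (use w in simp)
    qed
  qed
qed

lemma commuting_from_vertex:
  assumes e: "e \<in> V" and hom: "homogeneous V D"
    and eq: "\<And>v. v \<in> V \<Longrightarrow> common V D i j e v = common V D i j v e"
  shows "commuting V D i j"
  unfolding commuting_def
proof (intro ballI)
  fix u v assume uv: "u \<in> V" "v \<in> V"
  then obtain f where f: "isometry V D V D f" "f u = e" using hom e unfolding homogeneous_def by blast
  have "f v \<in> V" using f(1) uv by (auto simp: isometry_def bij_betw_def)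
  from eq[OF this] show "common V D i j u v = common V D i j v u"
    using isometry_common[OF f(1) uv, of i j] isometry_common[OF f(1) uv(2,1), of i j] f(2) by simp
qed

lemma common_set:
  "distinct xs \<Longrightarrow> common (set xs) D i j u v = length (filter (\<lambda>w. D u w = i \<and> D v w = j) xs)"
  unfolding common_def by (simp add: distinct_length_filter Int_def conj_commute)

lemma length_filter_eq_count:
  "length (filter (\<lambda>w. P w \<and> f w = j) xs) = count (mset (map f (filter P xs))) j"
  by (induction xs) auto

lemma length_filter_map_eq_count:
  "length (filter (\<lambda>w. f w = j) xs) = count (mset (map f xs)) j"
  by (induction xs) auto

text \<open>
  For fixed \<open>i\<close>, the counts for all \<open>j\<close> at once are the multiplicities in one multiset of distances,
  and two multisets can be compared by sorting.
\<close>

lemma common_eqI: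
  assumes "distinct xs"
    and "sort (map (D v) (filter (\<lambda>w. D u w = i) xs)) = sort (map (D u) (filter (\<lambda>w. D v w = i) xs))"
  shows "common (set xs) D i j u v = common (set xs) D i j v u"
proof -
  have count: "common (set xs) D i j x y = count (mset (map (D y) (filter (\<lambda>w. D x w = i) xs))) j" for x y
    by (simp only: common_set[OF assms(1)] length_filter_eq_count)
  have "mset (map (D v) (filter (\<lambda>w. D u w = i) xs)) = mset (map (D u) (filter (\<lambda>w. D v w = i) xs))"
    using arg_cong[OF assms(2), of mset] by (simp only: mset_sort)
  then show ?thesis by (simp only: count)
qed

section \<open>Two Cayley graphs\<close>

text \<open>
  The triple \<open>(i, x, t)\<close> stands for the element \<open>r\<^sup>i s\<^sup>x c\<^sup>t\<close> of the product of the dihedral group of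
  order \<open>2 n\<close> (rotation \<open>r\<close>, reflection \<open>s\<close>) and a cyclic group of order \<open>m\<close> (generator \<open>c\<close>).
\<close>

definition dihedral_cyclic :: "int \<Rightarrow> int \<Rightarrow> (int \<times> bool \<times> int) list" where
  "dihedral_cyclic n m = List.product [0..n - 1] (List.product [False, True] [0..m - 1])"

text \<open>
  The distance from \<open>u\<close> to \<open>v\<close> in a Cayley graph is the word length \<open>L\<close> of \<open>u\<close>-inverse times \<open>v\<close>, so that left
  multiplications are isometries.
\<close>

definition cayley_dist ::
  "int \<Rightarrow> int \<Rightarrow> (int \<Rightarrow> bool \<Rightarrow> int \<Rightarrow> nat) \<Rightarrow> int \<times> bool \<times> int \<Rightarrow> int \<times> bool \<times> int \<Rightarrow> nat" where
  "cayley_dist n m L u v = (case u of (i, x, t) \<Rightarrow> case v of (j, y, s) \<Rightarrow>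
     L ((if x then i - j else j - i) mod n) (x \<noteq> y) ((s - t) mod m))"

lemma in_dihedral_cyclic:
  "(i, x, t) \<in> set (dihedral_cyclic n m) \<longleftrightarrow> 0 \<le> i \<and> i < n \<and> 0 \<le> t \<and> t < m"
  by (auto simp: dihedral_cyclic_def)

lemma distinct_dihedral_cyclic: "distinct (dihedral_cyclic n m)"
  by (simp add: dihedral_cyclic_def distinct_product del: List.product.simps)

lemma homogeneous_cayley:
  assumes "0 < n" "0 < m"
  shows "homogeneous (set (dihedral_cyclic n m)) (cayley_dist n m L)" (is "homogeneous ?V ?D")
proof (rule homogeneousI)
  show "(0, False, 0) \<in> ?V" using assms by (simp add: in_dihedral_cyclic)
  fix g assume "g \<in> ?V"
  then obtain a b c where g: "g = (a, b, c)" "0 \<le> a" "a < n" "0 \<le> c" "c < m"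
    by (metis in_dihedral_cyclic prod_cases3)
  \<comment> \<open>left multiplication by \<open>g\<close> and by its inverse\<close>
  let ?f = "\<lambda>(i, x, t). ((if b then a - i else a + i) mod n, b \<noteq> x, (c + t) mod m)"
  let ?h = "\<lambda>(i, x, t). ((if b then a - i else i - a) mod n, b \<noteq> x, (t - c) mod m)"
  have "bij_betw ?f ?V ?V"
    by (rule bij_betw_byWitness[where f' = ?h])
       (use assms in \<open>auto simp: in_dihedral_cyclic mod_simps\<close>)
  moreover have "?D (?f u) (?f v) = ?D u v" for u v
    by (cases u; cases v) (auto simp: cayley_dist_def mod_simps)
  moreover have "?f (0, False, 0) = g" using g by simp
  ultimately show "\<exists>f. isometry ?V ?D ?V ?D f \<and> f (0, False, 0) = g"
    unfolding isometry_def by (intro exI[of _ ?f] conjI ballI)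
qed

text \<open>
  Integer positions let the simplifier evaluate table look-ups without converting the results of
  modular arithmetic to natural numbers.
\<close>

fun entry :: "'a list \<Rightarrow> int \<Rightarrow> 'a" where
  "entry (x # xs) i = (if i = 0 then x else entry xs (i - 1))"
| "entry [] i = undefined"

text \<open>
  Word lengths for the generators \<open>s\<close>, \<open>r s\<close>, \<open>r s c\<close>, \<open>c\<close> of the dihedral group of order \<open>6\<close> times the
  cyclic group of order \<open>2\<close>. Rows are indexed by the exponent of \<open>r\<close>, columns by that of \<open>c\<close>.
\<close>

definition word_length_12 :: "int \<Rightarrow> bool \<Rightarrow> int \<Rightarrow> nat" where
  "word_length_12 i x t = entry (entry
     (if x then [[1, 2], [1, 1], [3, 3]]
      else [[0, 1], [2, 2], [2, 2]]) i) t"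

text \<open>
  Word lengths for the generators
    \<open>r c\<^sup>2\<close>, \<open>r\<^sup>3 c\<^sup>6\<close>, \<open>r\<^sup>2 c\<close>, \<open>r\<^sup>2 c\<^sup>7\<close>, \<open>c\<^sup>4\<close>, \<open>s c\<^sup>4\<close>, \<open>r\<^sup>2 s c\<^sup>4\<close>, \<open>r\<^sup>3 s c\<^sup>3\<close>, \<open>r\<^sup>3 s c\<^sup>5\<close>
  of the dihedral group of order \<open>8\<close> times the cyclic group of order \<open>8\<close>.

  The choice is best seen in the two-dimensional irreducible representations, in which \<open>r\<^sup>2\<close> acts as
  \<open>-1\<close> and \<open>c\<close> as a scalar \<open>\<omega>\<close> with \<open>\<omega>\<^sup>8 = 1\<close>. The generators \<open>s c\<^sup>4\<close> and \<open>r\<^sup>2 s c\<^sup>4\<close> cancel, and the sum of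
  all generators is a scalar plus \<open>(\<omega>\<^sup>2 - \<omega>\<^sup>6) r + (\<omega>\<^sup>3 + \<omega>\<^sup>5) r\<^sup>3 s\<close>. When \<open>\<omega>\<close> has order \<open>4\<close>, both
  coefficients vanish: the adjacency matrix is a scalar there and commutes with everything, while
  the distance matrices \<open>A\<^sub>2\<close> and \<open>A\<^sub>3\<close> are free not to commute with each other. That they do
  not, and that the adjacency matrix commutes with all distance matrices in the other
  representations too, is a finite verification.
\<close>

definition word_length_64 :: "int \<Rightarrow> bool \<Rightarrow> int \<Rightarrow> nat" where
  "word_length_64 i x t = entry (entry
     (if x then
        [[2, 2, 3, 2, 1, 2, 3, 2], [3, 3, 2, 3, 2, 3, 2, 3],
         [2, 2, 3, 2, 1, 2, 3, 2], [4, 2, 2, 1, 4, 1, 2, 2]]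
      else
        [[0, 3, 2, 3, 1, 3, 2, 3], [3, 2, 1, 3, 3, 2, 2, 2],
         [2, 1, 4, 2, 2, 2, 4, 1], [3, 2, 2, 2, 3, 3, 1, 2]]) i) t"

abbreviation "V12 \<equiv> dihedral_cyclic 3 2"
abbreviation "D12 \<equiv> cayley_dist 3 2 word_length_12"
abbreviation "V64 \<equiv> dihedral_cyclic 4 8"
abbreviation "D64 \<equiv> cayley_dist 4 8 word_length_64"
abbreviation "identity \<equiv> (0 :: int, False, 0 :: int)"

lemma homogeneous_12: "homogeneous (set V12) D12"
  by (rule homogeneous_cayley) simp_all

lemma homogeneous_64: "homogeneous (set V64) D64"
  by (rule homogeneous_cayley) simp_all

lemma geodesic_12: "geodesic_space (set V12) D12"
proof (rule geodesic_space_from_vertex[OF _ _ homogeneous_12, where e = identity])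
  have zero: "\<forall>v\<in>set V12. D12 identity v = 0 \<longleftrightarrow> v = identity" by code_simp
  show "D12 identity v = 0 \<longleftrightarrow> v = identity" if "v \<in> set V12" for v
    by (rule bspec[OF zero that])
  have symm: "\<forall>v\<in>set V12. D12 identity v = D12 v identity" by code_simp
  show "D12 identity v = D12 v identity" if "v \<in> set V12" for v
    by (rule bspec[OF symm that])
  have step: "\<forall>w\<in>set V12. D12 identity w = 1 \<longrightarrow>
      (\<forall>v\<in>set V12. D12 identity v \<le> Suc (D12 w v))" by code_simp
  show "D12 identity v \<le> Suc (D12 w v)"
    if "w \<in> set V12" "v \<in> set V12" "D12 identity w = 1" for w v
    by (rule bspec[OF mp[OF bspec[OF step that(1)] that(3)] that(2)])
  have descend: "\<forall>v\<in>set V12. D12 identity v = 0 \<or>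
      (\<exists>w\<in>set V12. D12 identity w = 1 \<and> Suc (D12 w v) = D12 identity v)" by code_simp
  show "D12 identity v = 0 \<or>
      (\<exists>w\<in>set V12. D12 identity w = 1 \<and> Suc (D12 w v) = D12 identity v)"
    if "v \<in> set V12" for v
    by (rule bspec[OF descend that])
  show "identity \<in> set V12" by (simp add: in_dihedral_cyclic)
qed simp

lemma geodesic_64: "geodesic_space (set V64) D64"
proof (rule geodesic_space_from_vertex[OF _ _ homogeneous_64, where e = identity])
  have zero: "\<forall>v\<in>set V64. D64 identity v = 0 \<longleftrightarrow> v = identity" by code_simp
  show "D64 identity v = 0 \<longleftrightarrow> v = identity" if "v \<in> set V64" for v
    by (rule bspec[OF zero that])
  have symm: "\<forall>v\<in>set V64. D64 identity v = D64 v identity" by code_simp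
  show "D64 identity v = D64 v identity" if "v \<in> set V64" for v
    by (rule bspec[OF symm that])
  have step: "\<forall>w\<in>set V64. D64 identity w = 1 \<longrightarrow>
      (\<forall>v\<in>set V64. D64 identity v \<le> Suc (D64 w v))" by code_simp
  show "D64 identity v \<le> Suc (D64 w v)"
    if "w \<in> set V64" "v \<in> set V64" "D64 identity w = 1" for w v
    by (rule bspec[OF mp[OF bspec[OF step that(1)] that(3)] that(2)])
  have descend: "\<forall>v\<in>set V64. D64 identity v = 0 \<or>
      (\<exists>w\<in>set V64. D64 identity w = 1 \<and> Suc (D64 w v) = D64 identity v)" by code_simp
  show "D64 identity v = 0 \<or>
      (\<exists>w\<in>set V64. D64 identity w = 1 \<and> Suc (D64 w v) = D64 identity v)"
    if "v \<in> set V64" for v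
    by (rule bspec[OF descend that])
  show "identity \<in> set V64" by (simp add: in_dihedral_cyclic)
qed simp

lemma not_commuting_12: "\<not> commuting (set V12) D12 1 2"
proof
  let ?g = "(1 :: int, False, 0 :: int)"
  let ?count = "\<lambda>u v. length (filter (\<lambda>w. D12 u w = 1 \<and> D12 v w = 2) V12)"
  assume "commuting (set V12) D12 1 2"
  moreover have "identity \<in> set V12" "?g \<in> set V12" by (simp_all add: in_dihedral_cyclic)
  ultimately have "?count identity ?g = ?count ?g identity"
    unfolding commuting_def common_set[OF distinct_dihedral_cyclic] by blast
  moreover have "?count identity ?g \<noteq> ?count ?g identity" by code_simp
  ultimately show False by contradiction
qed

lemma not_commuting_64: "\<not> commuting (set V64) D64 2 3"
proof
  let ?g = "(0 :: int, True, 1 :: int)"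
  let ?count = "\<lambda>u v. length (filter (\<lambda>w. D64 u w = 2 \<and> D64 v w = 3) V64)"
  assume "commuting (set V64) D64 2 3"
  moreover have "identity \<in> set V64" "?g \<in> set V64" by (simp_all add: in_dihedral_cyclic)
  ultimately have "?count identity ?g = ?count ?g identity"
    unfolding commuting_def common_set[OF distinct_dihedral_cyclic] by blast
  moreover have "?count identity ?g \<noteq> ?count ?g identity" by code_simp
  ultimately show False by contradiction
qed

lemma commuting_1_64: "commuting (set V64) D64 1 j"
proof (rule commuting_from_vertex[OF _ homogeneous_64])
  show "identity \<in> set V64" by (simp add: in_dihedral_cyclic)
  have sorted_eq: "\<forall>v\<in>set V64. sort (map (D64 v) (filter (\<lambda>w. D64 identity w = 1) V64)) =
      sort (map (D64 identity) (filter (\<lambda>w. D64 v w = 1) V64))" by code_simp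
  show "common (set V64) D64 1 j identity v = common (set V64) D64 1 j v identity"
    if "v \<in> set V64" for v
    by (rule common_eqI[where D = D64 and u = identity and v = v and i = 1,
          OF distinct_dihedral_cyclic bspec[OF sorted_eq that]])
qed

section \<open>A regular graph with unequal triangle counts\<close>

text \<open>
  The join of three isolated vertices \<open>0, 1, 2\<close> and two disjoint edges \<open>34\<close> and \<open>56\<close>. It is regular of
  degree \<open>4\<close> and diameter \<open>2\<close>, hence its distance matrices \<open>I\<close>, \<open>A\<close> and \<open>J - I - A\<close> commute; but
  a vertex of the first kind lies in two triangles and one of the second kind in three.
\<close>

definition join_dist :: "nat \<Rightarrow> nat \<Rightarrow> nat" where
  "join_dist u v =
     (if u = v then 0
      else if u < 3 \<and> v < 3 \<or> 3 \<le> u \<and> 3 \<le> v \<and> Suc u div 2 \<noteq> Suc v div 2 then 2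
      else 1)"

abbreviation "join_V \<equiv> [0, 1, 2, 3, 4, 5, 6 :: nat]"

lemma geodesic_join: "geodesic_space (set join_V) join_dist"
proof
  show "join_dist u v = 0 \<longleftrightarrow> u = v" for u v by (simp add: join_dist_def)
  show "join_dist u v = join_dist v u" for u v by (auto simp: join_dist_def)
  have "\<forall>u\<in>set join_V. \<forall>v\<in>set join_V. join_dist u v \<le> 2" by code_simp
  then show "join_dist u v \<le> Suc (join_dist w v)"
    if "u \<in> set join_V" "w \<in> set join_V" "v \<in> set join_V" "join_dist u w = 1" for u w v
    using that by (cases "w = v") (auto simp: join_dist_def)
  have *: "\<forall>u\<in>set join_V. \<forall>v\<in>set join_V. u = v \<or>
      (\<exists>w\<in>set join_V. join_dist u w = 1 \<and> Suc (join_dist w v) = join_dist u v)" by code_simp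
  show "\<exists>w\<in>set join_V. join_dist u w = 1 \<and> join_dist w v = k"
    if uv: "u \<in> set join_V" "v \<in> set join_V" and k: "join_dist u v = Suc k" for u v k
  proof -
    have "u \<noteq> v" using k by (auto simp: join_dist_def)
    with bspec[OF bspec[OF * uv(1)] uv(2)]
    obtain w where "w \<in> set join_V" "join_dist u w = 1" "Suc (join_dist w v) = join_dist u v"
      by blast
    with k show ?thesis by (intro bexI[of _ w]) simp_all
  qed
qed simp_all

lemma edges_in_triangles_join: "edges_in_triangles (set join_V) join_dist"
  unfolding edges_in_triangles_def by code_simp

lemma distance_degree_regular_join: "distance_degree_regular (set join_V) join_dist"
proof -
  have *: "\<forall>u\<in>set join_V. sort (map (join_dist u) join_V) = [0, 1, 1, 1, 1, 2, 2]" by code_simp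
  have "card (sphere (set join_V) join_dist i u) = count (mset [0, 1, 1, 1, 1, 2, 2]) i"
    if "u \<in> set join_V" for i u
  proof -
    have "card (sphere (set join_V) join_dist i u) = length (filter (\<lambda>w. join_dist u w = i) join_V)"
      unfolding sphere_def by (subst distinct_length_filter) (simp_all add: Int_def conj_commute)
    also have "\<dots> = count (mset (map (join_dist u) join_V)) i"
      by (rule length_filter_map_eq_count)
    also have "mset (map (join_dist u) join_V) = mset [0, 1, 1, 1, 1, 2, 2]"
      using arg_cong[OF bspec[OF * that], of mset] by (simp only: mset_sort)
    finally show ?thesis .
  qed
  then show ?thesis unfolding distance_degree_regular_def by simp
qed

lemma commuting_1_join: "commuting (set join_V) join_dist 1 j"
proof -
  have "\<forall>u\<in>set join_V. \<forall>v\<in>set join_V.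
      sort (map (join_dist v) (filter (\<lambda>w. join_dist u w = 1) join_V)) =
      sort (map (join_dist u) (filter (\<lambda>w. join_dist v w = 1) join_V))" by code_simp
  from common_eqI[OF _ bspec[OF bspec[OF this]]]
  show ?thesis unfolding commuting_def by simp
qed

lemma triangle_count_set:
  assumes "distinct xs"
  shows "triangle_count (set xs) D u =
    (\<Sum>v\<leftarrow>filter (\<lambda>v. D u v = 1) xs. length (filter (\<lambda>w. D u w = 1 \<and> D v w = 1) xs))"
  unfolding triangle_count_def sphere_def common_set[OF assms]
  using assms by (simp add: sum_list_distinct_conv_sum_set)

lemma triangle_count_join:
  "triangle_count (set join_V) join_dist 0 \<noteq> triangle_count (set join_V) join_dist 3"
proof -
  have d: "distinct join_V" by simp
  show ?thesis unfolding triangle_count_set[OF d] by code_simp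
qed

section \<open>Combining the building blocks\<close>

definition not_one_commuting :: "'a set \<Rightarrow> ('a \<Rightarrow> 'a \<Rightarrow> nat) \<Rightarrow> bool" where
  "not_one_commuting V D \<longleftrightarrow> (\<exists>j. \<not> commuting V D 1 j)"

text \<open>
  Restricting the failure to pairs \<open>(2, j)\<close> keeps the notion stable under products: the smaller pairs
  \<open>(1, j - 1)\<close> and \<open>(0, j - 2)\<close> commute, as the product argument requires.
\<close>

definition only_one_commuting :: "'a set \<Rightarrow> ('a \<Rightarrow> 'a \<Rightarrow> nat) \<Rightarrow> bool" where
  "only_one_commuting V D \<longleftrightarrow> (\<forall>j. commuting V D 1 j) \<and> (\<exists>j. \<not> commuting V D 2 j)"

context geodesic_product
begin

lemma not_one_commuting: "not_one_commuting V D \<Longrightarrow> not_one_commuting VW DE"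
proof -
  have "commuting V D (1 - s) (j - s)" if "0 < s" "s \<le> 1" for s j
    using that V.commuting_0 by simp
  then have "\<not> commuting VW DE 1 j" if "\<not> commuting V D 1 j" for j
    using not_commuting[OF that] by blast
  then show "not_one_commuting V D \<Longrightarrow> not_one_commuting VW DE"
    unfolding not_one_commuting_def by blast
qed

lemma only_one_commuting:
  assumes D: "only_one_commuting V D" and E: "\<And>j. commuting W E 1 j"
  shows "only_one_commuting VW DE"
proof -
  have one: "commuting V D 1 j" for j using D by (simp add: only_one_commuting_def)
  have "commuting V D (2 - s) (j - s)" if "0 < s" "s \<le> 2" for s j
  proof -
    consider "s = 1" | "s = 2" using \<open>0 < s\<close> \<open>s \<le> 2\<close> by linarith
    then show ?thesis using one V.commuting_0 by cases simp_all
  qed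
  then have "\<not> commuting VW DE 2 j" if "\<not> commuting V D 2 j" for j
    using not_commuting[OF that] by blast
  with D commuting_1[OF one E] show ?thesis unfolding only_one_commuting_def by blast
qed

end

context geodesic_space
begin

lemma not_one_commuting_graph: "not_one_commuting V D \<Longrightarrow> \<not> one_CDDR G"
  by (simp add: not_one_commuting_def one_CDDR_iff)

lemma only_one_commuting_graph: "only_one_commuting V D \<Longrightarrow> one_CDDR G \<and> \<not> CDDR G"
  unfolding only_one_commuting_def one_CDDR_iff CDDR_iff by blast

lemma not_one_commuting_twin: "not_one_commuting V D \<Longrightarrow> not_one_commuting twin_V twin_D"
  and only_one_commuting_twin: "only_one_commuting V D \<Longrightarrow> only_one_commuting twin_V twin_D"
  by (simp_all add: not_one_commuting_def only_one_commuting_def commuting_twin)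

end

definition large :: "nat \<Rightarrow> nat \<Rightarrow> 'a set \<Rightarrow> ('a \<Rightarrow> 'a \<Rightarrow> nat) \<Rightarrow> bool" where
  "large n d V D \<longleftrightarrow> n \<le> card V \<and> (\<exists>u\<in>V. \<exists>v\<in>V. d \<le> D u v)"

lemma (in geodesic_product) large_product: 
  assumes "large n d V D" shows "large n d VW DE"
proof -
  obtain u v w where "u \<in> V" "v \<in> V" "d \<le> D u v" "w \<in> W"
    using assms W.nonempty_V unfolding large_def by blast
  then have "\<exists>x\<in>VW. \<exists>y\<in>VW. d \<le> DE x y"
    by (intro bexI[of _ "(u, w)"] bexI[of _ "(v, w)"]) auto
  moreover have "n \<le> card VW"
  proof -
    have "card V * 1 \<le> card V * card W"
      using W.finite_V W.nonempty_V by (intro mult_le_mono2) (simp add: Suc_le_eq card_gt_0_iff)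
    moreover have "n \<le> card V" using assms by (simp add: large_def)
    ultimately show ?thesis by (simp only: card_cartesian_product mult_1_right)
  qed
  ultimately show ?thesis unfolding large_def by blast
qed

text \<open>
  The graph \<open>H\<close> inherits the commutation type of \<open>(V, D)\<close>, and its mean-regularity is decided by
  \<open>(V, D)\<close> in the two ways available here: transitivity for, unequal triangle counts against.
\<close>

definition realizes :: "'a set \<Rightarrow> ('a \<Rightarrow> 'a \<Rightarrow> nat) \<Rightarrow> nat \<Rightarrow> nat \<Rightarrow> bool \<Rightarrow> nat pair_pre_digraph \<Rightarrow> bool" where
  "realizes V D n d dwr H \<longleftrightarrow>
     connected_simple_graph H \<and> n \<le> card (pverts H) \<and> d \<le> graph_diam H \<and> DDR H \<and>
     (DWR H \<longleftrightarrow> dwr) \<and>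
     (not_one_commuting V D \<longrightarrow> \<not> one_CDDR H) \<and>
     (only_one_commuting V D \<longrightarrow> one_CDDR H \<and> \<not> CDDR H) \<and>
     (homogeneous V D \<longrightarrow> DMR H) \<and>
     ((\<exists>u\<in>V. \<exists>v\<in>V. triangle_count V D u \<noteq> triangle_count V D v) \<longrightarrow> \<not> DMR H)"

lemma (in geodesic_space) realizes_graph:
  assumes "large n d V D" "distance_degree_regular V D" "DWR G \<longleftrightarrow> dwr"
  shows "\<exists>H. realizes V D n d dwr H"
proof -
  obtain H :: "nat pair_pre_digraph" where H: "connected_simple_graph H"
    "card (pverts H) = card V" "graph_diam H = graph_diam G" "DDR H = DDR G"
    "one_CDDR H = one_CDDR G" "CDDR H = CDDR G" "DMR H = DMR G" "DWR H = DWR G"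
    using nat_copy[OF geodesic_space_axioms] by blast
  moreover have "d \<le> graph_diam G"
    using assms(1) dist_le_diam unfolding large_def by (meson le_trans)
  moreover have "n \<le> card V" using assms(1) by (simp add: large_def)
  ultimately have "realizes V D n d dwr H"
    unfolding realizes_def
    using assms(2,3) DDR_iff not_one_commuting_graph only_one_commuting_graph homogeneous_DMR
      not_DMR[OF assms(2)] by auto
  then show ?thesis ..
qed

lemma realizes_product:
  assumes "geodesic_product V D W E" and W: "homogeneous W E" "\<And>j. commuting W E 1 j"
    and H: "realizes (V \<times> W) (product_dist D E) n d dwr H"
  shows "realizes V D n d dwr H"
proof -
  interpret geodesic_product V D W E by fact
  obtain w where w: "w \<in> W" using W.nonempty_V by blast
  have "\<exists>x\<in>VW. \<exists>y\<in>VW. triangle_count VW DE x \<noteq> triangle_count VW DE y"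
    if "u \<in> V" "v \<in> V" "triangle_count V D u \<noteq> triangle_count V D v" for u v
    using that w by (intro bexI[of _ "(u, w)"] bexI[of _ "(v, w)"]) (auto simp: triangle_count)
  then show ?thesis
    using H not_one_commuting only_one_commuting[OF _ W(2)] homogeneous[OF _ W(1)]
    unfolding realizes_def by blast
qed

text \<open>
  Multiplication by a single edge destroys walk-regularity, since that edge lies in no
  triangle, and it affects neither the commutation type nor the differences of triangle counts.
\<close>

lemma exists_realization:
  assumes V: "geodesic_space V D" and "large n d V D" and reg: "distance_degree_regular V D"
    and tri: "edges_in_triangles V D"
  shows "\<exists>H. realizes V D n d dwr H"
proof -
  interpret V: geodesic_space V D by fact
  show ?thesis
  proof (cases dwr)
    case True
    then show ?thesis using V.realizes_graph[OF assms(2) reg] V.triangles_DWR[OF tri] by simp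
  next
    case False
    let ?W = "Pow {..<1 :: nat}"
    interpret P: geodesic_product V D ?W cube_dist
      by (intro geodesic_product.intro V geodesic_cube)
    interpret VW: geodesic_space P.VW P.DE by (rule P.geodesic)
    have "\<not> DWR (graph_of P.VW P.DE)"
    proof (rule P.not_DWR[OF tri, of "{}" "{0}"])
      fix z :: "nat set" assume "z \<in> ?W" "cube_dist {} z = 1" "cube_dist z {0} = 1"
      then have "z = {} \<or> z = {0}" by auto
      with \<open>cube_dist {} z = 1\<close> \<open>cube_dist z {0} = 1\<close> show False by (auto simp: cube_dist_def)
    qed (auto simp: cube_dist_def)
    then obtain H where "realizes P.VW P.DE n d dwr H"
      using VW.realizes_graph[OF P.large_product[OF assms(2)]]
        P.distance_degree_regular[OF reg homogeneous_distance_degree_regular[OF homogeneous_cube]] False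
      by blast
    then show ?thesis
      using realizes_product[OF P.geodesic_product_axioms homogeneous_cube commuting_cube] by blast
  qed
qed

text \<open>
  The cube factor provides size and diameter; doubling the vertices of the product afterwards puts
  every edge into a triangle.
\<close>

lemma grow:
  fixes V :: "'a set"
  assumes "geodesic_space V D" "homogeneous V D"
  shows "\<exists>(W :: (('a \<times> nat set) \<times> bool) set) E. geodesic_space W E \<and> homogeneous W E \<and> edges_in_triangles W E \<and>
    large n d W E \<and> (not_one_commuting V D \<longrightarrow> not_one_commuting W E) \<and>
    (only_one_commuting V D \<longrightarrow> only_one_commuting W E)"
proof -
  define m where "m = Suc (max n d)"
  interpret P: geodesic_product V D "Pow {..<m}" cube_dist
    by (intro geodesic_product.intro assms geodesic_cube)
  interpret VW: geodesic_space P.VW P.DE by (rule P.geodesic)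
  obtain a where a: "a \<in> V" using P.V.nonempty_V by blast
  have other: "\<exists>v\<in>P.VW. v \<noteq> u" if "u \<in> P.VW" for u
  proof (cases "snd u = {}")
    case True
    then show ?thesis using a by (intro bexI[of _ "(a, {0})"]) (auto simp: m_def)
  next
    case False
    then show ?thesis using a by (intro bexI[of _ "(a, {})"]) auto
  qed
  have "m < 2 ^ m" by (rule less_exp)
  moreover have "0 < card V" using a P.V.finite_V by (auto simp: card_gt_0_iff)
  ultimately have "n \<le> card V * 2 ^ m * 2"
    using mult_le_mono[of 1 "card V" m "2 ^ m"] by (simp add: m_def)
  then have card: "n \<le> card VW.twin_V" by (simp add: card_cartesian_product card_Pow)
  have "cube_dist {} {..<m} = m" by (simp add: cube_dist_def)
  then have "d \<le> VW.twin_D ((a, {}), True) ((a, {..<m}), True)"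
    using a P.V.dist_refl by (auto simp: twin_dist_def m_def)
  with card a have "large n d VW.twin_V VW.twin_D"
    unfolding large_def
    by (intro conjI bexI[of _ "((a, {}), True)"] bexI[of _ "((a, {..<m}), True)"]) auto
  moreover have "homogeneous VW.twin_V VW.twin_D"
    by (intro VW.homogeneous_twin P.homogeneous assms homogeneous_cube)
  moreover have "not_one_commuting V D \<longrightarrow> not_one_commuting VW.twin_V VW.twin_D"
    "only_one_commuting V D \<longrightarrow> only_one_commuting VW.twin_V VW.twin_D"
    using P.not_one_commuting P.only_one_commuting[OF _ commuting_cube]
      VW.not_one_commuting_twin VW.only_one_commuting_twin by blast+
  ultimately show ?thesis
    using VW.geodesic_twin VW.edges_in_triangles_twin[OF other] by blast
qed

text \<open>
  Mean-regularity comes from transitivity; it is destroyed by the factor with unequal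
  triangle counts, in which all edges lie in triangles, so that walk-regularity is still free to
  be chosen.
\<close>

lemma all_combinations:
  fixes V :: "'a set"
  assumes "geodesic_space V D" "homogeneous V D"
  shows "\<exists>H :: nat pair_pre_digraph. connected_simple_graph H \<and> n \<le> card (pverts H) \<and>
    d \<le> graph_diam H \<and> DDR H \<and> (DMR H \<longleftrightarrow> dmr) \<and> (DWR H \<longleftrightarrow> dwr) \<and>
    (not_one_commuting V D \<longrightarrow> \<not> one_CDDR H) \<and>
    (only_one_commuting V D \<longrightarrow> one_CDDR H \<and> \<not> CDDR H)"
proof -
  obtain W :: "(('a \<times> nat set) \<times> bool) set" and E where W: "geodesic_space W E" "homogeneous W E"
    "edges_in_triangles W E" "large n d W E"
    and com: "not_one_commuting V D \<longrightarrow> not_one_commuting W E"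
      "only_one_commuting V D \<longrightarrow> only_one_commuting W E"
    using grow[OF assms, of n d] by blast
  have reg: "distance_degree_regular W E" using W(2) by (rule homogeneous_distance_degree_regular)
  show ?thesis
  proof (cases dmr)
    case True
    obtain H where "realizes W E n d dwr H"
      using exists_realization[OF W(1) W(4) reg W(3)] by blast
    then show ?thesis using True W(2) com unfolding realizes_def by blast
  next
    case False
    interpret P: geodesic_product W E "set join_V" join_dist
      by (intro geodesic_product.intro W geodesic_join)
    obtain w where w: "w \<in> W" using P.V.nonempty_V by blast
    moreover have "0 \<in> set join_V" "3 \<in> set join_V" by simp_all
    ultimately have "triangle_count P.VW P.DE (w, 0) \<noteq> triangle_count P.VW P.DE (w, 3)"
      using triangle_count_join by (simp only: P.triangle_count)
    moreover have "(w, 0) \<in> P.VW" "(w, 3) \<in> P.VW" using w by auto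
    ultimately have tri: "\<exists>u\<in>P.VW. \<exists>v\<in>P.VW. triangle_count P.VW P.DE u \<noteq> triangle_count P.VW P.DE v"
      by blast
    obtain H where H: "realizes P.VW P.DE n d dwr H"
      using exists_realization[OF P.geodesic P.large_product[OF W(4)]
        P.distance_degree_regular[OF reg distance_degree_regular_join]
        P.edges_in_triangles[OF W(3) edges_in_triangles_join]] by blast
    then have "\<not> DMR H" using tri unfolding realizes_def by blast
    then show ?thesis
      using H False com P.not_one_commuting P.only_one_commuting[OF _ commuting_1_join]
      unfolding realizes_def by blast
  qed
qed

theorem corollary7p6:
  fixes n d :: nat
  shows
    "(\<forall>dmr dwr :: bool. \<exists>G :: nat pair_pre_digraph.
        connected_simple_graph G \<and> card (pverts G) \<ge> n \<and> graph_diam G \<ge> d \<and>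
        DDR G \<and> \<not> one_CDDR G \<and> (DMR G \<longleftrightarrow> dmr) \<and> (DWR G \<longleftrightarrow> dwr)) \<and>
     (\<forall>dmr dwr :: bool. \<exists>G :: nat pair_pre_digraph.
        connected_simple_graph G \<and> card (pverts G) \<ge> n \<and> graph_diam G \<ge> d \<and>
        one_CDDR G \<and> \<not> CDDR G \<and> (DMR G \<longleftrightarrow> dmr) \<and> (DWR G \<longleftrightarrow> dwr))"
proof (intro conjI allI)
  fix dmr dwr :: bool
  have "not_one_commuting (set V12) D12"
    unfolding not_one_commuting_def using not_commuting_12 by blast
  then show "\<exists>G :: nat pair_pre_digraph.
        connected_simple_graph G \<and> card (pverts G) \<ge> n \<and> graph_diam G \<ge> d \<and>
        DDR G \<and> \<not> one_CDDR G \<and> (DMR G \<longleftrightarrow> dmr) \<and> (DWR G \<longleftrightarrow> dwr)"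
    using all_combinations[OF geodesic_12 homogeneous_12, of n d dmr dwr] by blast
  have "only_one_commuting (set V64) D64"
    unfolding only_one_commuting_def using commuting_1_64 not_commuting_64 by blast
  then show "\<exists>G :: nat pair_pre_digraph.
        connected_simple_graph G \<and> card (pverts G) \<ge> n \<and> graph_diam G \<ge> d \<and>
        one_CDDR G \<and> \<not> CDDR G \<and> (DMR G \<longleftrightarrow> dmr) \<and> (DWR G \<longleftrightarrow> dwr)"
    using all_combinations[OF geodesic_64 homogeneous_64, of n d dmr dwr] by blast
qed

end
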